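(* Let $P:[1,\infty)\to\mathbb{R}$ be a tail bound function (defined below) that is convex and non-increasing on $[1,\infty)$ and satisfies $P(1)\le1$. Then for every $\beta\ge1$, the approximation ratio of the kernel $\alpha$-point rounding algorithm with parameter $\beta$ (described below) for GMSSC is at most $\beta\, r(\beta)$, where \[ r(\beta)=e^{1/\beta}\Big(1+\frac1\beta\int_1^\infty P(x)\,e^{\frac{x-1}{\beta}}\,dx\Big).\] In particular, for the bound $P(\gamma)=e^{1-\gamma}/2$ this gives approximation ratio $\beta(2\beta-1)e^{1/\beta}/(2\beta-2)$, which is at most $4.9102$ for $\beta=2.191$; and for the bound $P(\gamma)=e^{-\gamma}(e/2)^{\exp(1-\gamma)}$ the approximation ratio is at most $4.642$ for $\beta=2.0715$.
   Context: GMSSC: input a finite hypergraph $H=(V,E)$, $n=|V|$, each $e\in E$ having a requirement $k_e\in\mathbb{Z}^+$, $k_e\le|e|$. A solution is a bijection $\sigma:V\to\{1,\dots,n\}$; the cover time of $e$ is the smallest $t$ with $|\{v\in e:\sigma(v)\le t\}|\ge k_e$; the objective is the sum of cover times. A tail bound function is a function $P$ such that for every positive integer $k$, every $\gamma\ge1$, and every finite family of independent Bernoulli random variables $Y_v$ with $\mathbb{E}[\sum_vY_v]=\gamma k$, one has $\Pr[\sum_vY_v\le k-1]\le P(\gamma)$. LP relaxation: variables $x_{v,t}\ge0$, $u_{e,t}\ge0$ ($v\in V,e\in E,t\in\{1,\dots,n\}$); minimize $\sum_{e,t}u_{e,t}$ subject to $\sum_vx_{v,t}\le1$ for all $t$,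 and for all $e,t$ and $S\subseteq e$ with $|S|<k_e$: $(k_e-|S|)u_{e,t}+\sum_{v\in e\setminus S}\sum_{t'<t}x_{v,t'}\ge k_e-|S|$. Algorithm with parameter $\beta$: (1) compute an optimal LP solution $x$; (2) for every $v$ and integer $t\ge1$ set $z_{v,t}=\frac{\beta}{t}\sum_{t'\le t}x_{v,t'}$ (with $x_{v,t'}=0$ for $t'>n$); (3) for each $v$ independently draw $\alpha_v$ uniformly from $[0,1]$ and let $\tau(v)$ be the earliest integer $t\ge1$ with $\sum_{t'\le t}z_{v,t'}\ge\alpha_v$; (4) output the ordering of $V$ sorting vertices by $\tau(v)$, ties broken uniformly at random. The approximation ratio means the expected cost of the output divided by the optimum, maximized over instances. *)

theory Defs
  imports "HOL-Probability.Probability"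
begin

definition gmssc_instance :: "'v set \<Rightarrow> 'v set set \<Rightarrow> ('v set \<Rightarrow> nat) \<Rightarrow> bool" where
  "gmssc_instance V E k \<longleftrightarrow>
     finite V \<and> (\<forall>e\<in>E. e \<subseteq> V \<and> 1 \<le> k e \<and> k e \<le> card e)"

text \<open>Orderings are taken extensional, so that there are exactly \<open>fact (card V)\<close> of them and
  the uniform distribution on a set of orderings makes sense.\<close>

definition orderings :: "'v set \<Rightarrow> ('v \<Rightarrow> nat) set" where
  "orderings V = {\<sigma> \<in> V \<rightarrow>\<^sub>E {1..card V}. bij_betw \<sigma> V {1..card V}}"

definition cover_time :: "('v set \<Rightarrow> nat) \<Rightarrow> ('v \<Rightarrow> nat) \<Rightarrow> 'v set \<Rightarrow> nat" where
  "cover_time k \<sigma> e = (LEAST t. k e \<le> card {v \<in> e. \<sigma> v \<le> t})"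

definition gmssc_cost :: "'v set set \<Rightarrow> ('v set \<Rightarrow> nat) \<Rightarrow> ('v \<Rightarrow> nat) \<Rightarrow> nat" where
  "gmssc_cost E k \<sigma> = (\<Sum>e\<in>E. cover_time k \<sigma> e)"

definition gmssc_opt :: "'v set \<Rightarrow> 'v set set \<Rightarrow> ('v set \<Rightarrow> nat) \<Rightarrow> nat" where
  "gmssc_opt V E k = Min (gmssc_cost E k ` orderings V)"

definition lp_feasible ::
  "'v set \<Rightarrow> 'v set set \<Rightarrow> ('v set \<Rightarrow> nat) \<Rightarrow> ('v \<Rightarrow> nat \<Rightarrow> real) \<Rightarrow> ('v set \<Rightarrow> nat \<Rightarrow> real) \<Rightarrow> bool"
where
  "lp_feasible V E k x u \<longleftrightarrow>
     (\<forall>v\<in>V. \<forall>t\<in>{1..card V}. 0 \<le> x v t) \<and>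
     (\<forall>e\<in>E. \<forall>t\<in>{1..card V}. 0 \<le> u e t) \<and>
     (\<forall>t\<in>{1..card V}. (\<Sum>v\<in>V. x v t) \<le> 1) \<and>
     (\<forall>e\<in>E. \<forall>t\<in>{1..card V}. \<forall>S. S \<subseteq> e \<and> card S < k e \<longrightarrow>
        (real (k e) - real (card S)) * u e t + (\<Sum>v\<in>e - S. \<Sum>t'\<in>{1..<t}. x v t')
          \<ge> real (k e) - real (card S))"

definition lp_value :: "'v set \<Rightarrow> 'v set set \<Rightarrow> ('v set \<Rightarrow> nat \<Rightarrow> real) \<Rightarrow> real" where
  "lp_value V E u = (\<Sum>e\<in>E. \<Sum>t\<in>{1..card V}. u e t)"

definition lp_optimal ::
  "'v set \<Rightarrow> 'v set set \<Rightarrow> ('v set \<Rightarrow> nat) \<Rightarrow> ('v \<Rightarrow> nat \<Rightarrow> real) \<Rightarrow> ('v set \<Rightarrow> nat \<Rightarrow> real) \<Rightarrow> bool"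
where
  "lp_optimal V E k x u \<longleftrightarrow>
     lp_feasible V E k x u \<and>
     (\<forall>x' u'. lp_feasible V E k x' u' \<longrightarrow> lp_value V E u \<le> lp_value V E u')"

definition kernel_z :: "'v set \<Rightarrow> real \<Rightarrow> ('v \<Rightarrow> nat \<Rightarrow> real) \<Rightarrow> 'v \<Rightarrow> nat \<Rightarrow> real" where
  "kernel_z V \<beta> x v t = \<beta> / real t * (\<Sum>t'\<in>{1..t}. if t' \<le> card V then x v t' else 0)"

text \<open>If \<open>x v\<close> vanishes identically, the threshold is never reached unless \<open>\<alpha> v = 0\<close>; the
  infimum of the empty set is then \<open>\<infinity>\<close>, which puts \<open>v\<close> behind all vertices with finite value.\<close>

definition alpha_point ::
  "'v set \<Rightarrow> real \<Rightarrow> ('v \<Rightarrow> nat \<Rightarrow> real) \<Rightarrow> ('v \<Rightarrow> real) \<Rightarrow> 'v \<Rightarrow> enat" where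
  "alpha_point V \<beta> x \<alpha> v =
     Inf (enat ` {t. 1 \<le> t \<and> \<alpha> v \<le> (\<Sum>t'\<in>{1..t}. kernel_z V \<beta> x v t')})"

text \<open>The orderings of \<open>V\<close> sorted by \<open>\<tau>\<close>. A uniformly random element of this set is the sorted
  order with ties broken uniformly at random, independently in each class of ties.\<close>

definition sorted_orderings :: "'v set \<Rightarrow> ('v \<Rightarrow> enat) \<Rightarrow> ('v \<Rightarrow> nat) set" where
  "sorted_orderings V \<tau> = {\<sigma> \<in> orderings V. \<forall>v\<in>V. \<forall>w\<in>V. \<tau> v < \<tau> w \<longrightarrow> \<sigma> v < \<sigma> w}"

definition expected_cost ::
  "'v set \<Rightarrow> 'v set set \<Rightarrow> ('v set \<Rightarrow> nat) \<Rightarrow> real \<Rightarrow> ('v \<Rightarrow> nat \<Rightarrow> real) \<Rightarrow> ennreal" where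
  "expected_cost V E k \<beta> x =
     (\<integral>\<^sup>+ \<alpha>. (\<integral>\<^sup>+ \<sigma>. of_nat (gmssc_cost E k \<sigma>)
               \<partial>measure_pmf (pmf_of_set (sorted_orderings V (alpha_point V \<beta> x \<alpha>))))
        \<partial>PiM V (\<lambda>_. uniform_measure lborel {0..1}))"

text \<open>The supremum also ranges over all optimal LP solutions, so a bound on it holds whichever
  optimal solution is computed. For an instance without edges the quotient is \<open>0 / 0 = 0\<close>.
  The type argument is the type from which vertices are taken.\<close>

definition approx_ratio :: "'v itself \<Rightarrow> real \<Rightarrow> ennreal" where
  "approx_ratio (_ :: 'v itself) \<beta> =
     Sup {expected_cost V E k \<beta> x / of_nat (gmssc_opt V E k)
          | (V :: 'v set) E k x u. gmssc_instance V E k \<and> lp_optimal V E k x u}"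

text \<open>The condition only depends on the joint law of the finite family, so it is no restriction
  to take indices in \<open>nat\<close> and a sample space inside \<open>nat \<Rightarrow> bool\<close>.\<close>

definition tail_bound_function :: "(real \<Rightarrow> real) \<Rightarrow> bool" where
  "tail_bound_function P \<longleftrightarrow>
     (\<forall>(k :: nat) (\<gamma> :: real) (M :: (nat \<Rightarrow> bool) measure) (I :: nat set)
         (Y :: nat \<Rightarrow> (nat \<Rightarrow> bool) \<Rightarrow> real).
        1 \<le> k \<and> 1 \<le> \<gamma> \<and> prob_space M \<and> finite I \<and>
        prob_space.indep_vars M (\<lambda>_. borel) Y I \<and>
        (\<forall>i\<in>I. \<forall>\<omega>\<in>space M. Y i \<omega> \<in> {0, 1}) \<and>
        prob_space.expectation M (\<lambda>\<omega>. \<Sum>i\<in>I. Y i \<omega>) = \<gamma> * real k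
        \<longrightarrow> prob_space.prob M {\<omega> \<in> space M. (\<Sum>i\<in>I. Y i \<omega>) \<le> real k - 1} \<le> P \<gamma>)"

text \<open>A tail bound function is nonnegative on \<open>{1..}\<close>, so nothing is lost by the coercion to
  \<open>ennreal\<close>; the integral may be \<open>\<infinity>\<close>.\<close>

definition kernel_r :: "(real \<Rightarrow> real) \<Rightarrow> real \<Rightarrow> ennreal" where
  "kernel_r P \<beta> =
     ennreal (exp (1 / \<beta>)) *
       (1 + ennreal (1 / \<beta>) * (\<integral>\<^sup>+ x\<in>{1..}. ennreal (P x * exp ((x - 1) / \<beta>)) \<partial>lborel))"

definition tail_half_exp :: "real \<Rightarrow> real" where
  "tail_half_exp \<gamma> = exp (1 - \<gamma>) / 2"

definition tail_double_exp :: "real \<Rightarrow> real" where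
  "tail_double_exp \<gamma> = exp (- \<gamma>) * (exp 1 / 2) powr exp (1 - \<gamma>)"

end

theory Submission
  imports Defs
begin

text \<open>Fix an edge \<open>e\<close> with requirement \<open>k\<close>, let \<open>U\<close> be its share of the LP value and \<open>Z v t\<close> the
  accumulated kernel mass of \<open>v\<close>, so that \<open>v\<close> is reached by time \<open>t\<close> with probability \<open>min 1 (Z v t)\<close>.
  The knapsack cover inequalities and the kernel weights \<open>1 / s\<close> give every residual instance of \<open>e\<close> at
  time \<open>t\<close> an expected coverage of at least \<open>\<beta> ln ((t + 1) / U)\<close> times its residual requirement. Hence
  from time \<open>t0 = \<lfloor>U exp (1 / \<beta>)\<rfloor>\<close> on, \<open>P (\<beta> ln ((t + 1) / U))\<close> bounds the probability that \<open>e\<close> is not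
  yet covered, and summing over \<open>t\<close> yields \<open>U r(\<beta>)\<close> by the substitution \<open>t = U exp (y / \<beta>)\<close>.
  Let \<open>T\<close> be the first time \<open>\<ge> t0\<close> at which \<open>e\<close> is covered. The position of \<open>e\<close> in the output is at most
  \<open>k\<close> plus the number of vertices outside \<open>e\<close> reached by time \<open>T\<close>; those are independent of \<open>T\<close>, and since
  \<open>T \<ge> t0\<close> the number \<open>k\<close> is at most the kernel mass of \<open>e\<close> at time \<open>T\<close>. As the total kernel mass at
  time \<open>T\<close> is at most \<open>\<beta> T\<close>, the expected position is at most \<open>\<beta>\<close> times the expectation of \<open>T\<close>.

  For the two explicit bounds, replacing Bernoulli variables by Poisson variables of the same mean
  increases the tail below the mean, and the Poisson tail at mean \<open>\<gamma> k\<close> is estimated by comparing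
  logarithmic derivatives in \<open>\<gamma>\<close>, starting from the value at most \<open>1 / 2\<close> at \<open>\<gamma> = 1\<close>.\<close>

section \<open>Tails of sums of Bernoulli variables\<close>

text \<open>Probability generating function of a sum of independent Bernoulli variables with success
  probabilities \<open>p i\<close>. Working with its coefficients keeps the comparison of tails
  algebraic, free of probability spaces.\<close>

definition bernoulli_gf :: "('a \<Rightarrow> real) \<Rightarrow> 'a set \<Rightarrow> real fps" where
  "bernoulli_gf p I = (\<Prod>i\<in>I. fps_const (1 - p i) + fps_const (p i) * fps_X)"

definition poisson_gf :: "real \<Rightarrow> real fps" where
  "poisson_gf \<mu> = Abs_fps (\<lambda>j. exp (- \<mu>) * \<mu> ^ j / fact j)"

text \<open>Point mass at \<open>j\<close> of a Poisson variable of mean \<open>\<mu>\<close> plus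
  an independent Bernoulli sum. The family interpolates between a pure Bernoulli sum
  (\<open>\<mu> = 0\<close>) and a pure Poisson variable (\<open>I = {}\<close>).\<close>

definition mixed_mass :: "real \<Rightarrow> ('a \<Rightarrow> real) \<Rightarrow> 'a set \<Rightarrow> nat \<Rightarrow> real" where
  "mixed_mass \<mu> p I j = fps_nth (poisson_gf \<mu> * bernoulli_gf p I) j"

text \<open>The bound \<open>k\<close> is exclusive: this is the probability of at most
  \<open>k - 1\<close> successes.\<close>

definition bernoulli_tail :: "('a \<Rightarrow> real) \<Rightarrow> 'a set \<Rightarrow> nat \<Rightarrow> real" where
  "bernoulli_tail p I k = (\<Sum>j<k. fps_nth (bernoulli_gf p I) j)"

lemma poisson_gf_0: "poisson_gf 0 = 1"
  by (auto simp: poisson_gf_def fps_eq_iff)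

lemma mixed_mass_empty: "mixed_mass \<mu> p {} j = exp (- \<mu>) * \<mu> ^ j / fact j"
  by (simp add: mixed_mass_def bernoulli_gf_def poisson_gf_def)

lemma mixed_mass_insert_0:
  assumes "finite I" "i \<notin> I"
  shows "mixed_mass \<mu> p (insert i I) 0 = (1 - p i) * mixed_mass \<mu> p I 0"
  using assms by (simp add: mixed_mass_def bernoulli_gf_def)

lemma mixed_mass_insert_Suc:
  assumes "finite I" "i \<notin> I"
  shows "mixed_mass \<mu> p (insert i I) (Suc j)
    = (1 - p i) * mixed_mass \<mu> p I (Suc j) + p i * mixed_mass \<mu> p I j"
proof -
  have "poisson_gf \<mu> * bernoulli_gf p (insert i I)
     = fps_const (1 - p i) * (poisson_gf \<mu> * bernoulli_gf p I)
       + fps_const (p i) * (fps_X * (poisson_gf \<mu> * bernoulli_gf p I))"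
    using assms by (simp add: bernoulli_gf_def algebra_simps)
  then show ?thesis
    unfolding mixed_mass_def by (simp del: fps_const_sub)
qed

lemmas mixed_mass_insert = mixed_mass_insert_0 mixed_mass_insert_Suc

lemma mixed_mass_nonneg:
  assumes "finite I" "\<And>i. i \<in> I \<Longrightarrow> 0 \<le> p i \<and> p i \<le> 1" "0 \<le> \<mu>"
  shows "0 \<le> mixed_mass \<mu> p I j"
  using assms
proof (induction I arbitrary: j rule: finite_induct)
  case empty
  then show ?case by (simp add: mixed_mass_empty)
next
  case (insert i I)
  then show ?case by (cases j) (auto simp: mixed_mass_insert)
qed

lemma mixed_mass_remove_0:
  assumes "finite I" "i \<in> I"
  shows "mixed_mass \<mu> p I 0 = (1 - p i) * mixed_mass \<mu> p (I - {i}) 0"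
  using mixed_mass_insert_0[of "I - {i}" i \<mu> p] assms by (simp add: insert_absorb)

lemma mixed_mass_remove_Suc:
  assumes "finite I" "i \<in> I"
  shows "mixed_mass \<mu> p I (Suc j)
    = (1 - p i) * mixed_mass \<mu> p (I - {i}) (Suc j) + p i * mixed_mass \<mu> p (I - {i}) j"
  using mixed_mass_insert_Suc[of "I - {i}" i \<mu> p j] assms by (simp add: insert_absorb)

text \<open>Coefficient form of the product rule for the generating function: the Poisson factor
  differentiates to \<open>\<mu>\<close> times itself, and the factor of \<open>i\<close> to
  \<open>p i\<close>, which leaves the product over \<open>I - {i}\<close>. The proof is an
  induction on \<open>I\<close>.\<close>

lemma mixed_mass_size_bias:
  assumes "finite I"
  shows "real (Suc j) * mixed_mass \<mu> p I (Suc j)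
    = \<mu> * mixed_mass \<mu> p I j + (\<Sum>i\<in>I. p i * mixed_mass \<mu> p (I - {i}) j)"
  using assms
proof (induction I arbitrary: j rule: finite_induct)
  case empty
  have "fact (Suc j) = real (Suc j) * fact j" "real (Suc j) \<noteq> 0" by simp_all
  then show ?case by (simp add: mixed_mass_empty field_simps del: fact_Suc of_nat_Suc)
next
  case (insert a I)
  have diff: "insert a I - {i} = insert a (I - {i})" if "i \<in> I" for i
    using that insert by auto
  have a: "insert a I - {a} = I" using insert by auto
  have split: "(\<Sum>i\<in>insert a I. p i * mixed_mass \<mu> p (insert a I - {i}) j)
     = p a * mixed_mass \<mu> p I j + (\<Sum>i\<in>I. p i * mixed_mass \<mu> p (insert a (I - {i})) j)"
    using insert a diff by (simp cong: sum.cong)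
  show ?case
  proof (cases j)
    case 0
    have "(\<Sum>i\<in>I. p i * mixed_mass \<mu> p (insert a (I - {i})) j)
       = (1 - p a) * (\<Sum>i\<in>I. p i * mixed_mass \<mu> p (I - {i}) j)"
      using insert 0 by (simp add: mixed_mass_insert sum_distrib_left mult_ac)
    then show ?thesis
      using insert.IH[of 0] insert.hyps split 0
      by (simp add: mixed_mass_insert algebra_simps)
  next
    case (Suc m)
    have "(\<Sum>i\<in>I. p i * mixed_mass \<mu> p (insert a (I - {i})) j)
       = (1 - p a) * (\<Sum>i\<in>I. p i * mixed_mass \<mu> p (I - {i}) (Suc m))
         + p a * (\<Sum>i\<in>I. p i * mixed_mass \<mu> p (I - {i}) m)"
      using insert Suc
      by (simp add: mixed_mass_insert sum_distrib_left sum.distrib[symmetric] algebra_simps)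
    \<comment> \<open>Splitting \<open>Suc (Suc m)\<close> as \<open>Suc m + 1\<close> in the second
      summand makes both terms instances of the induction hypothesis; the leftover is the summand of
      \<open>a\<close> itself.\<close>
    moreover have "real (Suc (Suc m)) * mixed_mass \<mu> p (insert a I) (Suc (Suc m))
      = (1 - p a) * (real (Suc (Suc m)) * mixed_mass \<mu> p I (Suc (Suc m)))
        + p a * (real (Suc m) * mixed_mass \<mu> p I (Suc m)) + p a * mixed_mass \<mu> p I (Suc m)"
      using insert.hyps by (simp add: mixed_mass_insert algebra_simps)
    ultimately show ?thesis
      unfolding Suc
      using split[unfolded Suc] mixed_mass_insert_Suc[OF insert.hyps, of \<mu> p m]
      by (simp only: insert.IH Suc) (simp add: algebra_simps)
  qed
qed

text \<open>Darroch's rule: below its mean the mass function is nondecreasing. Removing the \<open>i\<close>-th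
  variable lowers the mean by at most one, so the size-bias identity allows induction.\<close>

lemma mixed_mass_increasing_below_mean:
  assumes "finite I" "\<And>i. i \<in> I \<Longrightarrow> 0 \<le> p i \<and> p i \<le> 1" "0 \<le> \<mu>"
    and "real (Suc j) \<le> \<mu> + sum p I"
  shows "mixed_mass \<mu> p I j \<le> mixed_mass \<mu> p I (Suc j)"
  using assms
proof (induction I arbitrary: j rule: finite_psubset_induct)
  case (psubset I)
  \<comment> \<open>The left side is a convex combination of the masses of \<open>I - {i}\<close> at
    \<open>j\<close> and at \<open>j - 1\<close>, and the latter is the smaller one by
    induction.\<close>
  have step: "mixed_mass \<mu> p I j \<le> mixed_mass \<mu> p (I - {i}) j" if i: "i \<in> I" for i
  proof (cases j)
    case 0
    have "0 \<le> mixed_mass \<mu> p (I - {i}) 0"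
      using psubset by (intro mixed_mass_nonneg) auto
    then show ?thesis
      using psubset.prems(1)[OF i] psubset.hyps i 0
      by (simp add: mixed_mass_remove_0[of I i] mult_left_le_one_le)
  next
    case (Suc m)
    have "sum p I = p i + sum p (I - {i})"
      using psubset.hyps i by (simp add: sum.remove)
    moreover have "p i \<le> 1" using psubset.prems(1) i by simp
    ultimately have "real (Suc m) \<le> \<mu> + sum p (I - {i})"
      using psubset.prems(3) Suc by simp
    then have "mixed_mass \<mu> p (I - {i}) m \<le> mixed_mass \<mu> p (I - {i}) (Suc m)"
      using psubset.prems i by (intro psubset.IH) auto
    then have "p i * mixed_mass \<mu> p (I - {i}) m \<le> p i * mixed_mass \<mu> p (I - {i}) (Suc m)"
      using psubset.prems(1)[OF i] by (intro mult_left_mono) auto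
    then show ?thesis
      using psubset.hyps i Suc by (simp add: mixed_mass_remove_Suc[of I i] algebra_simps)
  qed
  have nn: "0 \<le> mixed_mass \<mu> p I j"
    using psubset by (intro mixed_mass_nonneg) auto
  have "real (Suc j) * mixed_mass \<mu> p I j \<le> (\<mu> + sum p I) * mixed_mass \<mu> p I j"
    using psubset.prems nn by (intro mult_right_mono) auto
  also have "\<dots> = \<mu> * mixed_mass \<mu> p I j + (\<Sum>i\<in>I. p i * mixed_mass \<mu> p I j)"
    by (simp add: sum_distrib_right algebra_simps)
  also have "\<dots> \<le> \<mu> * mixed_mass \<mu> p I j + (\<Sum>i\<in>I. p i * mixed_mass \<mu> p (I - {i}) j)"
    using step psubset.prems by (intro add_left_mono sum_mono mult_left_mono) auto
  also have "\<dots> = real (Suc j) * mixed_mass \<mu> p I (Suc j)"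
    using mixed_mass_size_bias psubset.hyps by metis
  finally show ?case
    by (simp only: mult_le_cancel_left_pos of_nat_0_less_iff zero_less_Suc)
qed

section \<open>Replacing Bernoulli variables by Poisson mass\<close>

text \<open>The Poisson generating function is \<open>exp (\<mu> * (X - 1))\<close>, so
  differentiating in \<open>\<mu>\<close> multiplies by \<open>X - 1\<close>: the mass at
  \<open>j - 1\<close>, read as 0 for \<open>j = 0\<close>, minus the mass at
  \<open>j\<close>.\<close>

lemma mixed_mass_deriv:
  assumes "finite I"
  shows "((\<lambda>x. mixed_mass x p I j) has_real_derivative
           (case j of 0 \<Rightarrow> 0 | Suc m \<Rightarrow> mixed_mass x p I m) - mixed_mass x p I j) (at x)"
  using assms
proof (induction I arbitrary: j rule: finite_induct)
  case empty
  show ?case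
  proof (cases j)
    case 0
    then show ?thesis
      unfolding mixed_mass_empty by (auto intro!: derivative_eq_intros)
  next
    case (Suc m)
    have fa: "fact (Suc m) = real (Suc m) * fact m" "real (Suc m) \<noteq> 0" by simp_all
    have "((\<lambda>x. exp (- x) * x ^ Suc m / fact (Suc m)) has_real_derivative
        (exp (- x) * (-1) * x ^ Suc m + (real (Suc m) * x ^ m) * exp (- x)) / fact (Suc m)) (at x)"
      by (rule derivative_eq_intros refl | simp)+
    then show ?thesis
      unfolding mixed_mass_empty Suc
      by (rule DERIV_cong) (simp add: fa field_simps del: fact_Suc of_nat_Suc)
  qed
next
  case (insert i I)
  show ?case
  proof (cases j)
    case 0
    then show ?thesis
      using insert.hyps DERIV_cmult[OF insert.IH[of 0], of "1 - p i"]
      by (simp add: mixed_mass_insert algebra_simps)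
  next
    case (Suc m)
    have "((\<lambda>x. (1 - p i) * mixed_mass x p I (Suc m) + p i * mixed_mass x p I m) has_real_derivative
       (1 - p i) * (mixed_mass x p I m - mixed_mass x p I (Suc m)) +
       p i * ((case m of 0 \<Rightarrow> 0 | Suc m \<Rightarrow> mixed_mass x p I m) - mixed_mass x p I m)) (at x)"
      using insert.IH[of "Suc m"] insert.IH[of m]
      by (intro DERIV_add DERIV_cmult) simp_all
    then show ?thesis
      using insert.hyps Suc
      by (cases m) (simp_all add: mixed_mass_insert algebra_simps)
  qed
qed

text \<open>The derivatives of the single masses telescope.\<close>

lemma mixed_mass_sum_deriv:
  assumes "finite I"
  shows "((\<lambda>x. \<Sum>j\<le>c. mixed_mass x p I j) has_real_derivative - mixed_mass x p I c) (at x)"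
proof (induction c)
  case 0
  then show ?case using mixed_mass_deriv[OF assms, of p 0] by simp
next
  case (Suc c)
  show ?case
    using DERIV_add[OF Suc mixed_mass_deriv[OF assms, of p "Suc c"]] by simp
qed

text \<open>A success of the new variable takes the total out of \<open>{..c}\<close> exactly when
  it was equal to \<open>c\<close> before.\<close>

lemma mixed_mass_sum_insert:
  assumes "finite I" "i \<notin> I"
  shows "(\<Sum>j\<le>c. mixed_mass \<mu> p (insert i I) j)
       = (\<Sum>j\<le>c. mixed_mass \<mu> p I j) - p i * mixed_mass \<mu> p I c"
  using assms by (induction c) (auto simp: mixed_mass_insert algebra_simps)

text \<open>Moving the mean of one Bernoulli variable gradually into the Poisson variable changes the tail
  at rate \<open>(p i - s) * (mixed_mass \<dots> c - mixed_mass \<dots> (c - 1))\<close>, which is nonnegative by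
  Darroch's rule.\<close>

lemma mixed_mass_sum_replace:
  assumes I: "finite I" "i \<notin> I" and p: "\<And>j. j \<in> insert i I \<Longrightarrow> 0 \<le> p j \<and> p j \<le> 1"
    and l: "0 \<le> \<mu>" and mean: "real (Suc c) \<le> \<mu> + sum p (insert i I)"
  shows "(\<Sum>j\<le>c. mixed_mass \<mu> p (insert i I) j) \<le> (\<Sum>j\<le>c. mixed_mass (\<mu> + p i) p I j)"
proof -
  \<comment> \<open>By \<open>mixed_mass_sum_insert\<close>, \<open>\<phi> s\<close> is the tail
    when the Poisson mean is \<open>s\<close> and the variable \<open>i\<close> has success
    probability \<open>\<mu> + p i - s\<close>. The total mean is the same for all
    \<open>s\<close>.\<close>
  define \<phi> where "\<phi> s = (\<Sum>j\<le>c. mixed_mass s p I j) - (\<mu> + p i - s) * mixed_mass s p I c" for s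
  have "\<phi> \<mu> \<le> \<phi> (\<mu> + p i)"
  proof (rule DERIV_nonneg_imp_nondecreasing[of \<mu> "\<mu> + p i" \<phi>])
    show "\<mu> \<le> \<mu> + p i" using p by auto
  next
    fix s assume s: "\<mu> \<le> s" "s \<le> \<mu> + p i"
    let ?d = "(\<mu> + p i - s) * (mixed_mass s p I c - (case c of 0 \<Rightarrow> 0 | Suc m \<Rightarrow> mixed_mass s p I m))"
    have "((\<lambda>s. \<mu> + p i - s) has_real_derivative - 1) (at s)"
      by (auto intro!: derivative_eq_intros)
    note DERIV_mult[OF this mixed_mass_deriv[OF I(1), of p c]]
    from DERIV_diff[OF mixed_mass_sum_deriv[OF I(1), of p c] this]
    have "(\<phi> has_real_derivative
        - mixed_mass s p I c - ((- 1) * mixed_mass s p I c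
          + ((case c of 0 \<Rightarrow> 0 | Suc m \<Rightarrow> mixed_mass s p I m) - mixed_mass s p I c) * (\<mu> + p i - s))) (at s)"
      unfolding \<phi>_def
      .
    then have d: "(\<phi> has_real_derivative ?d) (at s)"
      by (rule DERIV_cong) (simp add: algebra_simps)
    have "(case c of 0 \<Rightarrow> 0 | Suc m \<Rightarrow> mixed_mass s p I m) \<le> mixed_mass s p I c"
    proof (cases c)
      case 0
      then show ?thesis using mixed_mass_nonneg[of I p s 0] I p l s by auto
    next
      case (Suc m)
      \<comment> \<open>Dropping \<open>i\<close> costs at most 1 of the mean, and the index drops
        by 1 as well.\<close>
      have "real (Suc m) \<le> s + sum p I"
        using mean I p[of i] s Suc by simp
      then show ?thesis
        using mixed_mass_increasing_below_mean[of I p s m] I p l s Suc by auto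
    qed
    then have "0 \<le> ?d" using s by simp
    with d show "\<exists>y. (\<phi> has_real_derivative y) (at s) \<and> 0 \<le> y" by blast
  qed
  then show ?thesis by (simp add: \<phi>_def mixed_mass_sum_insert I)
qed

lemma mixed_mass_sum_le_poisson:
  assumes "finite I" "\<And>i. i \<in> I \<Longrightarrow> 0 \<le> p i \<and> p i \<le> 1" "0 \<le> \<mu>"
    and "real (Suc c) \<le> \<mu> + sum p I"
  shows "(\<Sum>j\<le>c. mixed_mass \<mu> p I j) \<le> (\<Sum>j\<le>c. mixed_mass (\<mu> + sum p I) p {} j)"
  using assms
proof (induction I arbitrary: \<mu> rule: finite_induct)
  case empty
  then show ?case by simp
next
  case (insert i I)
  have "(\<Sum>j\<le>c. mixed_mass \<mu> p (insert i I) j) \<le> (\<Sum>j\<le>c. mixed_mass (\<mu> + p i) p I j)"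
    using insert by (intro mixed_mass_sum_replace) auto
  also have "\<dots> \<le> (\<Sum>j\<le>c. mixed_mass (\<mu> + p i + sum p I) p {} j)"
    using insert.prems insert.hyps by (intro insert.IH) (auto simp: add.assoc)
  finally show ?case using insert.hyps by (simp add: add.assoc)
qed

lemma bernoulli_tail_le_poisson:
  assumes "finite I" "\<And>i. i \<in> I \<Longrightarrow> 0 \<le> p i \<and> p i \<le> 1" and k: "1 \<le> k" "real k \<le> sum p I"
  shows "bernoulli_tail p I k \<le> (\<Sum>j<k. exp (- sum p I) * sum p I ^ j / fact j)"
proof -
  obtain c where c: "k = Suc c" using k by (cases k) auto
  have "bernoulli_tail p I k = (\<Sum>j\<le>c. mixed_mass 0 p I j)"
    by (simp add: bernoulli_tail_def mixed_mass_def poisson_gf_0 c lessThan_Suc_atMost)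
  also have "\<dots> \<le> (\<Sum>j\<le>c. mixed_mass (0 + sum p I) p {} j)"
    using assms c by (intro mixed_mass_sum_le_poisson) auto
  finally show ?thesis by (simp add: mixed_mass_empty c lessThan_Suc_atMost)
qed

text \<open>The terms with indices \<open>k - 1 - i\<close> and \<open>k + i\<close> are compared; their ratio is a product of factors
  \<open>(k - m) * (k + m) \<le> k * k\<close>.\<close>

lemma poisson_le_half:
  fixes k :: nat
  shows "(\<Sum>j<k. real k ^ j / fact j) \<le> exp (real k) / 2"
proof -
  define a where "a j = real k ^ j / fact j" for j
  have refl_le: "a (k - Suc i) \<le> a (k + i)" if "i < k" for i
    using that
  proof (induction i)
    case 0
    then obtain m where "k = Suc m" by (cases k) auto
    moreover have "fact (Suc m) = real (Suc m) * fact m" "real (Suc m) \<noteq> 0" by simp_all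
    ultimately show ?case
      unfolding a_def by (simp add: field_simps del: fact_Suc of_nat_Suc)
  next
    case (Suc i)
    define m where "m = k - Suc (Suc i)"
    have k: "k = m + Suc (Suc i)" using Suc.prems by (simp add: m_def)
    have a_Suc: "a (Suc j) * real (Suc j) = a j * real k" for j
    proof -
      have "fact (Suc j) = real (Suc j) * fact j" "real (Suc j) \<noteq> 0" by simp_all
      then show ?thesis
        unfolding a_def by (simp add: field_simps del: fact_Suc of_nat_Suc)
    qed
    have down: "a m * real k = a (Suc m) * real (Suc m)"
      using a_Suc[of m] by simp
    have up: "a (k + Suc i) * real (k + Suc i) = a (k + i) * real k"
      using a_Suc[of "k + i"] by simp
    have ih: "a (Suc m) \<le> a (k + i)"
      using Suc k by simp
    have nn: "0 \<le> a j" for j by (simp add: a_def)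
    have kp: "0 < real k" using k by simp
    have "a m * (real k * real (k + Suc i)) = a (Suc m) * (real (Suc m) * real (k + Suc i))"
      using down by (simp add: algebra_simps)
    also have "\<dots> \<le> a (Suc m) * (real k * real k)"
      using nn k by (intro mult_left_mono) (simp_all add: algebra_simps)
    also have "\<dots> \<le> a (k + i) * (real k * real k)"
      using ih by (intro mult_right_mono) auto
    also have "\<dots> = a (k + Suc i) * (real k * real (k + Suc i))"
      using arg_cong[OF up, of "\<lambda>r. r * real k"] by (simp only: mult_ac)
    finally have "a m \<le> a (k + Suc i)"
      using kp by (subst (asm) mult_le_cancel_right_pos) auto
    then show ?case using k by simp
  qed
  \<comment> \<open>The first \<open>k\<close> terms are reflected onto the indices from
    \<open>k\<close> to \<open>2 * k - 1\<close>, so twice their sum is at most a partial sum of the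
    exponential series.\<close>
  have "2 * (\<Sum>j<k. a j) = (\<Sum>i<k. a (k - Suc i)) + (\<Sum>j<k. a j)"
    by (simp add: sum.nat_diff_reindex)
  also have "\<dots> \<le> (\<Sum>i<k. a (k + i)) + (\<Sum>j<k. a j)"
    using refl_le by (intro add_right_mono sum_mono) auto
  also have "\<dots> = (\<Sum>j<k + k. a j)"
  proof -
    have "(\<Sum>j<k + m. a j) = (\<Sum>i<m. a (k + i)) + (\<Sum>j<k. a j)" for m
      by (induction m) simp_all
    then show ?thesis by simp
  qed
  also have "\<dots> \<le> exp (real k)"
  proof -
    have "a = (\<lambda>n. inverse (fact n) * real k ^ n)"
      by (simp add: a_def fun_eq_iff field_simps)
    then have "summable a" "exp (real k) = suminf a"
      using summable_exp[of "real k"] by (simp_all add: exp_def scaleR_conv_of_real)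
    then show ?thesis
      using sum_le_suminf[of a "{..<k + k}"] by (simp add: a_def)
  qed
  finally show ?thesis by (simp add: a_def)
qed

section \<open>Poisson hazard rate and the doubly exponential bound\<close>

text \<open>Stirling-type bound on the Poisson mass near the mean. From \<open>k\<close> to
  \<open>Suc k\<close> the left side grows by \<open>exp 1 * k\<close> and the right side by
  \<open>(1 + 1 / k) ^ Suc k * k\<close>, which is at least as much. The inequality fails at 2,
  hence the start at 3.\<close>

lemma power_ge_exp_fact:
  assumes "3 \<le> k"
  shows "2 / 3 * exp (real k) * fact (k - 1) \<le> real k ^ k"
  using assms
proof (induction k rule: dec_induct)
  case base
  have "exp (1 :: real) \<le> 2.72"
    using e_less_272 by simp
  then have "exp (1::real) ^ 3 \<le> 2.72 ^ 3"
    by (intro power_mono) auto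
  then have "exp (3::real) \<le> 2.72 ^ 3"
    by (simp flip: exp_of_nat_mult)
  then show ?case by (simp add: fact_numeral eval_nat_numeral)
next
  case (step k)
  define x where "x = real (Suc k) / real k"
  have kp: "0 < real k" using step by simp
  have "1 - 1 / x \<le> ln x"
    using ln_le_minus_one[of "1 / x"] kp by (simp add: x_def ln_div)
  then have "1 \<le> real (Suc k) * ln x"
    using kp by (simp add: x_def field_simps)
  then have "exp 1 \<le> exp (real (Suc k) * ln x)" by simp
  also have "\<dots> = x ^ Suc k"
    using kp by (simp add: exp_of_nat_mult x_def del: of_nat_Suc)
  finally have e: "exp 1 \<le> x ^ Suc k" .
  have f: "fact k = real k * fact (k - 1)"
    using step by (simp add: fact_reduce)
  have "2 / 3 * exp (real (Suc k)) * fact k = (2 / 3 * exp (real k) * fact (k - 1)) * (exp 1 * real k)"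
    unfolding f by (simp add: exp_add)
  also have "\<dots> \<le> real k ^ k * (x ^ Suc k * real k)"
    using step.IH e kp by (intro mult_mono) (auto simp: x_def)
  also have "\<dots> = real (Suc k) ^ Suc k"
    using kp by (simp add: x_def power_divide del: of_nat_Suc)
  finally show ?case by simp
qed

text \<open>Up to the factor \<open>exp (- x)\<close>, the right side is minus the derivative in
  \<open>\<gamma>\<close> of the tail at mean \<open>x = \<gamma> * k\<close>; the logarithmic
  derivative is thus at most \<open>- 4 / 3\<close>. The worst case is \<open>x = k\<close>, where
  \<open>4 / 3\<close> is the quotient of the constants \<open>2 / 3\<close> of
  \<open>power_ge_exp_fact\<close> and \<open>1 / 2\<close> of \<open>poisson_le_half\<close>; for
  \<open>k = 2\<close> there is equality.\<close>

lemma poisson_hazard: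
  assumes k: "2 \<le> k" and x: "real k \<le> x"
  shows "4 / 3 * (\<Sum>j<k. x ^ j / fact j) \<le> real k * x ^ (k - 1) / fact (k - 1)"
proof -
  have kp: "0 < real k" using k by simp
  have *: "4 / 3 * (\<Sum>j<k. real k ^ j / fact j) \<le> real k * real k ^ (k - 1) / fact (k - 1)"
  proof (cases "k = 2")
    case True
    then show ?thesis by (simp add: eval_nat_numeral)
  next
    case False
    have "2 / 3 * exp (real k) * fact (k - 1) \<le> real k * real k ^ (k - 1)"
      using power_ge_exp_fact[of k] k False by (simp flip: power_Suc)
    then have "2 / 3 * exp (real k) \<le> real k * real k ^ (k - 1) / fact (k - 1)"
      by (simp add: field_simps)
    then show ?thesis using poisson_le_half[of k] by simp
  qed
  \<comment> \<open>Relative to the top power \<open>k - 1\<close>, every lower power loses weight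
    as \<open>x\<close> grows beyond \<open>k\<close>.\<close>
  have term_le: "x ^ j * real k ^ (k - 1) \<le> real k ^ j * x ^ (k - 1)" if "j < k" for j
  proof -
    have kk: "k - 1 = j + (k - 1 - j)" using that by simp
    have "real k ^ (k - 1 - j) \<le> x ^ (k - 1 - j)"
      using x kp by (intro power_mono) auto
    then have "(x ^ j * real k ^ j) * real k ^ (k - 1 - j) \<le> (x ^ j * real k ^ j) * x ^ (k - 1 - j)"
      using x kp by (intro mult_left_mono) auto
    then show ?thesis
      by (subst (1 2) kk) (simp add: power_add mult_ac)
  qed
  have "(4 / 3 * (\<Sum>j<k. x ^ j / fact j)) * real k ^ (k - 1)
      = 4 / 3 * (\<Sum>j<k. (x ^ j * real k ^ (k - 1)) / fact j)"
    by (simp add: sum_distrib_right sum_distrib_left mult_ac)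
  also have "\<dots> \<le> 4 / 3 * (\<Sum>j<k. (real k ^ j * x ^ (k - 1)) / fact j)"
    using term_le by (intro mult_left_mono sum_mono divide_right_mono) auto
  also have "\<dots> = (4 / 3 * (\<Sum>j<k. real k ^ j / fact j)) * x ^ (k - 1)"
    by (simp add: sum_distrib_right sum_distrib_left mult_ac)
  also have "\<dots> \<le> (real k * real k ^ (k - 1) / fact (k - 1)) * x ^ (k - 1)"
    using * x kp by (intro mult_right_mono) auto
  finally have "(4 / 3 * (\<Sum>j<k. x ^ j / fact j)) * real k ^ (k - 1)
     \<le> (real k * x ^ (k - 1) / fact (k - 1)) * real k ^ (k - 1)"
    by (simp add: mult_ac)
  then show ?thesis
    using kp by (subst (asm) mult_le_cancel_right_pos) auto
qed

lemma tail_double_exp_eq: "tail_double_exp \<gamma> = exp (- \<gamma>) * exp ((1 - ln 2) * exp (1 - \<gamma>))"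
  by (simp add: tail_double_exp_def powr_def ln_div)

lemma poisson_sum_deriv:
  "((\<lambda>x. \<Sum>j\<le>c. exp (- x) * x ^ j / fact j) has_real_derivative - (exp (- x) * x ^ c / fact c)) (at x)"
  using mixed_mass_sum_deriv[of "{}" "\<lambda>_. 0" c x] by (simp add: mixed_mass_empty)

lemma poisson_tail_le_double_exp:
  assumes k: "1 \<le> k" and \<gamma>: "1 \<le> \<gamma>"
  shows "(\<Sum>j<k. exp (- (\<gamma> * real k)) * (\<gamma> * real k) ^ j / fact j) \<le> tail_double_exp \<gamma>"
proof (cases "k = 1")
  case True
  have "0 \<le> (1 - ln 2) * exp (1 - \<gamma>)"
    using ln_2_less_1 by simp
  then have "1 \<le> exp ((1 - ln 2) * exp (1 - \<gamma>))" by simp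
  then show ?thesis
    using True by (simp add: tail_double_exp_eq)
next
  case False
  then obtain c where c: "k = Suc c" and k2: "2 \<le> k" using k by (cases k) auto
  define G where "G x = (\<Sum>j\<le>c. exp (- x) * x ^ j / fact j)" for x :: real
  define h where "h g = g - (1 - ln 2) * exp (1 - g)" for g :: real
  \<comment> \<open>Here \<open>exp (h g)\<close> is the reciprocal of
    \<open>tail_double_exp g\<close>, so \<open>\<Phi>\<close> is the quotient of tail and
    bound.\<close>
  define \<Phi> where "\<Phi> g = G (g * real k) * exp (h g)" for g
  have "\<Phi> \<gamma> \<le> \<Phi> 1"
  proof (rule DERIV_nonpos_imp_nonincreasing[OF \<gamma>])
    fix g :: real assume g: "1 \<le> g" "g \<le> \<gamma>"
    let ?x = "g * real k"
    have dG: "((\<lambda>g. G (g * real k)) has_real_derivative - (exp (- ?x) * ?x ^ c / fact c) * real k) (at g)"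
      unfolding G_def
      by (rule DERIV_chain2[OF poisson_sum_deriv]) (auto intro!: derivative_eq_intros)
    have dh: "((\<lambda>g. exp (h g)) has_real_derivative exp (h g) * (1 + (1 - ln 2) * exp (1 - g))) (at g)"
      unfolding h_def by (auto intro!: derivative_eq_intros)
    have d: "(\<Phi> has_real_derivative
        - (exp (- ?x) * ?x ^ c / fact c) * real k * exp (h g)
        + exp (h g) * (1 + (1 - ln 2) * exp (1 - g)) * G ?x) (at g)"
      unfolding \<Phi>_def by (rule DERIV_mult[OF dG dh])
    have G: "G ?x = exp (- ?x) * (\<Sum>j<k. ?x ^ j / fact j)"
      by (simp add: G_def c lessThan_Suc_atMost sum_distrib_left)
    have G0: "0 \<le> G ?x" unfolding G_def using g by (intro sum_nonneg) auto
    have "real k \<le> ?x" using g k by simp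
    from mult_left_mono[OF poisson_hazard[OF k2 this], of "exp (- ?x)"]
    have haz: "4 / 3 * G ?x \<le> exp (- ?x) * ?x ^ c / fact c * real k"
      unfolding G by (simp add: c mult_ac del: sum.lessThan_Suc of_nat_Suc)
    have "(1 - ln 2) * exp (1 - g) \<le> (1 - ln 2) * 1"
      using g ln_2_less_1 by (intro mult_left_mono) auto
    \<comment> \<open>The left side is minus the logarithmic derivative of the bound. It is at most
      \<open>2 - ln 2\<close>, and \<open>ln 2 \<ge> 2 / 3\<close> makes this meet the hazard
      constant.\<close>
    then have "1 + (1 - ln 2) * exp (1 - g) \<le> 4 / 3"
      using ln2_ge_two_thirds by simp
    then have "(1 + (1 - ln 2) * exp (1 - g)) * G ?x \<le> 4 / 3 * G ?x"
      using G0 by (intro mult_right_mono) auto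
    then have "exp (h g) * ((1 + (1 - ln 2) * exp (1 - g)) * G ?x - exp (- ?x) * ?x ^ c / fact c * real k) \<le> 0"
      using haz by (intro mult_nonneg_nonpos exp_ge_zero) linarith
    then have "- (exp (- ?x) * ?x ^ c / fact c) * real k * exp (h g)
        + exp (h g) * (1 + (1 - ln 2) * exp (1 - g)) * G ?x \<le> 0"
      by (simp add: algebra_simps)
    with d show "\<exists>y. (\<Phi> has_real_derivative y) (at g) \<and> y \<le> 0" by blast
  qed
  also have "\<Phi> 1 \<le> 1"
  proof -
    have "G (real k) = exp (- real k) * (\<Sum>j<k. real k ^ j / fact j)"
      by (simp add: G_def c lessThan_Suc_atMost sum_distrib_left)
    also have "\<dots> \<le> exp (- real k) * (exp (real k) / 2)"
      by (intro mult_left_mono poisson_le_half) auto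
    also have "\<dots> = 1 / 2" by (simp add: exp_minus)
    finally show ?thesis by (simp add: \<Phi>_def h_def)
  qed
  finally have "G (\<gamma> * real k) * exp (h \<gamma>) \<le> 1" by (simp add: \<Phi>_def)
  then have "G (\<gamma> * real k) \<le> exp (- h \<gamma>)"
    by (simp add: exp_minus field_simps)
  also have "exp (- h \<gamma>) = tail_double_exp \<gamma>"
    by (simp add: tail_double_exp_eq h_def flip: exp_add)
  finally show ?thesis by (simp add: G_def c lessThan_Suc_atMost)
qed

lemma bernoulli_tail_le_double_exp:
  assumes "finite I" "\<And>i. i \<in> I \<Longrightarrow> 0 \<le> p i \<and> p i \<le> 1" and k: "1 \<le> k" and \<gamma>: "1 \<le> \<gamma>"
    and mean: "sum p I = \<gamma> * real k"
  shows "bernoulli_tail p I k \<le> tail_double_exp \<gamma>"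
proof -
  have "real k \<le> sum p I" using \<gamma> k mean by simp
  from bernoulli_tail_le_poisson[OF assms(1,2) k this] poisson_tail_le_double_exp[OF k \<gamma>]
  show ?thesis unfolding mean by linarith
qed

section \<open>Orderings and the linear program\<close>

lemma sum_of_bool_eq_card:
  assumes "finite A"
  shows "(\<Sum>x\<in>A. of_bool (P x)) = real (card {x \<in> A. P x})"
  using assms
proof (induction A rule: finite_induct)
  case (insert a A)
  have "{x \<in> insert a A. P x} = (if P a then insert a {x \<in> A. P x} else {x \<in> A. P x})" by auto
  then show ?case using insert by simp
qed simp

lemma orderings_card_prefix:
  assumes "\<sigma> \<in> orderings V" "m \<le> card V"
  shows "card {v \<in> V. \<sigma> v \<le> m} = m"
proof -
  have bij: "bij_betw \<sigma> V {1..card V}" using assms by (simp add: orderings_def)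
  have "\<sigma> ` {v \<in> V. \<sigma> v \<le> m} = {1..m}"
  proof
    show "\<sigma> ` {v \<in> V. \<sigma> v \<le> m} \<subseteq> {1..m}"
      using bij by (auto dest: bij_betwE)
    show "{1..m} \<subseteq> \<sigma> ` {v \<in> V. \<sigma> v \<le> m}"
    proof
      fix j assume j: "j \<in> {1..m}"
      then have "j \<in> \<sigma> ` V" using bij assms by (auto simp: bij_betw_def)
      then show "j \<in> \<sigma> ` {v \<in> V. \<sigma> v \<le> m}" using j by auto
    qed
  qed
  moreover have "inj_on \<sigma> {v \<in> V. \<sigma> v \<le> m}"
    by (rule inj_on_subset[OF bij_betw_imp_inj_on[OF bij]]) auto
  ultimately show ?thesis
    using card_image[of \<sigma> "{v \<in> V. \<sigma> v \<le> m}"] by simp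
qed

lemma cover_time_le:
  assumes "k e \<le> card {v \<in> e. \<sigma> v \<le> t}"
  shows "cover_time k \<sigma> e \<le> t"
  unfolding cover_time_def using assms by (rule Least_le)

lemma orderings_card_edge:
  assumes "\<sigma> \<in> orderings V" "e \<subseteq> V"
  shows "{v \<in> e. \<sigma> v \<le> card V} = e"
  using assms by (auto simp: orderings_def PiE_def Pi_def)

lemma cover_time_le_card:
  assumes "\<sigma> \<in> orderings V" "e \<subseteq> V" "k e \<le> card e"
  shows "cover_time k \<sigma> e \<le> card V"
  using assms by (intro cover_time_le) (simp add: orderings_card_edge)

lemma cover_time_reached:
  assumes "\<sigma> \<in> orderings V" "e \<subseteq> V" "k e \<le> card e"
  shows "k e \<le> card {v \<in> e. \<sigma> v \<le> cover_time k \<sigma> e}"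
  unfolding cover_time_def
  by (rule LeastI[of _ "card V"]) (use assms in \<open>simp add: orderings_card_edge\<close>)

text \<open>The set \<open>Q\<close> of vertices reached by \<open>t\<close> is an initial segment
  of \<open>\<sigma>\<close>. Hence the first \<open>m\<close> positions lie in \<open>Q\<close>,
  and at most \<open>m - k e\<close> of them are occupied by vertices outside \<open>e\<close>,
  whatever the tie-breaking.\<close>

lemma cover_time_sorted_le:
  assumes V: "finite V" and e: "e \<subseteq> V" and \<sigma>: "\<sigma> \<in> sorted_orderings V \<tau>"
    and reach: "k e \<le> card {v \<in> e. \<tau> v \<le> t}"
  shows "cover_time k \<sigma> e \<le> k e + card {w \<in> V - e. \<tau> w \<le> t}"
proof (rule cover_time_le)
  define Q where "Q = {w \<in> V. \<tau> w \<le> t}"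
  define m where "m = k e + card {w \<in> V - e. \<tau> w \<le> t}"
  have ord: "\<sigma> \<in> orderings V" and
    sorted: "\<And>v w. v \<in> V \<Longrightarrow> w \<in> V \<Longrightarrow> \<tau> v < \<tau> w \<Longrightarrow> \<sigma> v < \<sigma> w"
    using \<sigma> by (auto simp: sorted_orderings_def)
  have inj: "inj_on \<sigma> V" and pos: "\<And>v. v \<in> V \<Longrightarrow> 1 \<le> \<sigma> v"
    using ord by (auto simp: orderings_def PiE_iff bij_betw_imp_inj_on)
  have "Q = {v \<in> e. \<tau> v \<le> t} \<union> {w \<in> V - e. \<tau> w \<le> t}"
    using e by (auto simp: Q_def)
  then have "card Q = card {v \<in> e. \<tau> v \<le> t} + card {w \<in> V - e. \<tau> w \<le> t}"
    using V e finite_subset[OF e V] by (simp add: card_Un_disjoint disjoint_iff)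
  then have mQ: "m \<le> card Q" using reach by (simp add: m_def)
  also have "card Q \<le> card V" using V by (auto simp: Q_def intro: card_mono)
  finally have mV: "m \<le> card V" .
  have sub: "v \<in> Q" if v: "v \<in> V" "\<sigma> v \<le> m" for v
  proof (rule ccontr)
    assume "v \<notin> Q"
    then have "t < \<tau> v" using v by (simp add: Q_def)
    have "\<sigma> ` Q \<subseteq> {1..<\<sigma> v}"
    proof
      fix j assume "j \<in> \<sigma> ` Q"
      then obtain w where w: "w \<in> V" "\<tau> w \<le> t" "j = \<sigma> w" by (auto simp: Q_def)
      then show "j \<in> {1..<\<sigma> v}"
        using sorted[OF w(1) v(1)] pos[OF w(1)] \<open>t < \<tau> v\<close> by simp
    qed
    then have "card (\<sigma> ` Q) \<le> card {1..<\<sigma> v}" by (intro card_mono) auto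
    moreover have "card (\<sigma> ` Q) = card Q"
      by (intro card_image inj_on_subset[OF inj]) (auto simp: Q_def)
    ultimately show False using v mQ pos[of v] by auto
  qed
  have "m = card {v \<in> V. \<sigma> v \<le> m}"
    using orderings_card_prefix[OF ord mV] by simp
  also have "\<dots> \<le> card ({v \<in> e. \<sigma> v \<le> m} \<union> {w \<in> V - e. \<tau> w \<le> t})"
    using sub finite_subset[OF e V] V unfolding Q_def by (intro card_mono) auto
  also have "\<dots> \<le> card {v \<in> e. \<sigma> v \<le> m} + card {w \<in> V - e. \<tau> w \<le> t}"
    by (rule card_Un_le)
  finally show "k e \<le> card {v \<in> e. \<sigma> v \<le> k e + card {w \<in> V - e. \<tau> w \<le> t}}"
    by (simp add: m_def)
qed

text \<open>Vertices are inserted in nondecreasing order of \<open>\<tau>\<close>, so each new one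
  can be placed last.\<close>

lemma sorted_orderings_nonempty:
  assumes "finite V"
  shows "sorted_orderings V \<tau> \<noteq> {}"
  using assms
proof (induction V rule: finite_ranking_induct[where f = \<tau>])
  case empty
  have "(\<lambda>_. undefined) \<in> sorted_orderings {} \<tau>"
    by (auto simp: sorted_orderings_def orderings_def bij_betw_def)
  then show ?case by blast
next
  case (insert a S)
  show ?case
  proof (cases "a \<in> S")
    case True
    then show ?thesis using insert.IH by (simp add: insert_absorb)
  next
    case False
    obtain \<sigma> where \<sigma>: "\<sigma> \<in> sorted_orderings S \<tau>" using insert.IH by blast
    define \<rho> where "\<rho> = \<sigma>(a := Suc (card S))"
    have bij: "bij_betw \<sigma> S {1..card S}" and ext: "\<sigma> \<in> S \<rightarrow>\<^sub>E {1..card S}"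
      using \<sigma> by (auto simp: sorted_orderings_def orderings_def)
    have range: "\<sigma> v \<le> card S" "1 \<le> \<sigma> v" if "v \<in> S" for v
      using ext that by (auto simp: PiE_def Pi_def)
    have eq: "\<rho> v = \<sigma> v" if "v \<in> S" for v using that False by (auto simp: \<rho>_def)
    have "bij_betw \<rho> S {1..card S}"
      using bij eq by (simp cong: bij_betw_cong)
    moreover have "bij_betw \<rho> {a} {Suc (card S)}" by (simp add: \<rho>_def)
    ultimately have "bij_betw \<rho> (S \<union> {a}) ({1..card S} \<union> {Suc (card S)})"
      by (rule bij_betw_combine) auto
    moreover have "{1..card S} \<union> {Suc (card S)} = {1..card (insert a S)}"
      using insert.hyps(1) False by auto
    ultimately have bij': "bij_betw \<rho> (insert a S) {1..card (insert a S)}" by simp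
    moreover have "\<rho> \<in> insert a S \<rightarrow>\<^sub>E {1..card (insert a S)}"
      using ext bij_betwE[OF bij'] by (auto simp: \<rho>_def PiE_iff extensional_def)
    moreover have "\<rho> v < \<rho> w" if "v \<in> insert a S" "w \<in> insert a S" "\<tau> v < \<tau> w" for v w
    proof -
      have "\<tau> w \<le> \<tau> a" using that(2) insert.hyps(2) by blast
      then have "v \<noteq> a" using that(3) by auto
      then have v: "v \<in> S" using that by simp
      show ?thesis
      proof (cases "w = a")
        case True
        then show ?thesis using eq[OF v] range[OF v] by (simp add: \<rho>_def)
      next
        case False
        then have "w \<in> S" using that by simp
        then show ?thesis using \<sigma> v that eq by (auto simp: sorted_orderings_def)
      qed
    qed
    ultimately have "\<rho> \<in> sorted_orderings (insert a S) \<tau>"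
      by (auto simp: sorted_orderings_def orderings_def)
    then show ?thesis by blast
  qed
qed

lemma finite_orderings: "finite V \<Longrightarrow> finite (orderings V)"
  unfolding orderings_def
  by (rule finite_subset[of _ "V \<rightarrow>\<^sub>E {1..card V}"]) (auto intro: finite_PiE)

lemma finite_sorted_orderings: "finite V \<Longrightarrow> finite (sorted_orderings V \<tau>)"
  by (rule finite_subset[OF _ finite_orderings]) (auto simp: sorted_orderings_def)

section \<open>The linear program as a relaxation\<close>

text \<open>The cover inequality at \<open>t\<close> counts only positions before \<open>t\<close>,
  so \<open>u e t\<close> must still be 1 at the cover time itself. After it, at least
  \<open>k e\<close> vertices of \<open>e\<close> precede \<open>t\<close>, and at most
  \<open>card S\<close> of them lie in \<open>S\<close>.\<close>

lemma ordering_lp_feasible: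
  assumes inst: "gmssc_instance V E k" and \<sigma>: "\<sigma> \<in> orderings V"
  shows "lp_feasible V E k (\<lambda>v t. of_bool (\<sigma> v = t)) (\<lambda>e t. of_bool (t \<le> cover_time k \<sigma> e))"
proof -
  have V: "finite V" and E: "\<And>e. e \<in> E \<Longrightarrow> e \<subseteq> V \<and> 1 \<le> k e \<and> k e \<le> card e"
    using inst by (auto simp: gmssc_instance_def)
  have inj: "inj_on \<sigma> V" and pos: "\<And>v. v \<in> V \<Longrightarrow> 1 \<le> \<sigma> v"
    using \<sigma> by (auto simp: orderings_def PiE_iff bij_betw_imp_inj_on)
  have "(\<Sum>v\<in>V. of_bool (\<sigma> v = t)) \<le> (1 :: real)" for t
  proof -
    have "card {v \<in> V. \<sigma> v = t} \<le> 1"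
      using V inj_onD[OF inj] card_le_Suc0_iff_eq[of "{v \<in> V. \<sigma> v = t}"] by simp
    moreover have "(\<Sum>v\<in>V. of_bool (\<sigma> v = t)) = real (card {v \<in> V. \<sigma> v = t})"
      using V by (rule sum_of_bool_eq_card)
    ultimately show ?thesis by simp
  qed
  moreover have "real (k e) - real (card S)
      \<le> (real (k e) - real (card S)) * of_bool (t \<le> cover_time k \<sigma> e)
        + (\<Sum>v\<in>e - S. \<Sum>t'\<in>{1..<t}. of_bool (\<sigma> v = t'))"
    if e: "e \<in> E" and S: "S \<subseteq> e" "card S < k e" for e t S
  proof (cases "t \<le> cover_time k \<sigma> e")
    case True
    then show ?thesis by (simp add: sum_nonneg)
  next
    case False
    have fin: "finite e" using finite_subset[OF _ V] E[OF e] by simp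
    have "finite S" using S(1) fin by (rule finite_subset)
    have "k e \<le> card {v \<in> e. \<sigma> v \<le> cover_time k \<sigma> e}"
      using cover_time_reached[OF \<sigma>] E[OF e] by blast
    also have "\<dots> \<le> card (S \<union> {v \<in> e - S. \<sigma> v < t})"
      using False fin \<open>finite S\<close> by (intro card_mono) auto
    also have "\<dots> \<le> card S + card {v \<in> e - S. \<sigma> v < t}" by (rule card_Un_le)
    finally have "real (k e) - real (card S) \<le> real (card {v \<in> e - S. \<sigma> v < t})" by linarith
    also have "\<dots> = (\<Sum>v\<in>e - S. of_bool (\<sigma> v < t))"
      using fin by (simp only: sum_of_bool_eq_card finite_Diff)
    also have "\<dots> = (\<Sum>v\<in>e - S. \<Sum>t'\<in>{1..<t}. of_bool (\<sigma> v = t'))"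
    proof (intro sum.cong refl)
      fix v assume "v \<in> e - S"
      then have "1 \<le> \<sigma> v" using pos E[OF e] by blast
      then show "of_bool (\<sigma> v < t) = (\<Sum>t'\<in>{1..<t}. of_bool (\<sigma> v = t') :: real)"
        by (simp add: of_bool_def)
    qed
    finally show ?thesis using False by simp
  qed
  ultimately show ?thesis unfolding lp_feasible_def by (intro conjI ballI allI impI) auto
qed

lemma lp_optimal_le_opt:
  assumes inst: "gmssc_instance V E k" and opt: "lp_optimal V E k x u"
  shows "lp_value V E u \<le> real (gmssc_opt V E k)"
proof -
  have V: "finite V" and E: "\<And>e. e \<in> E \<Longrightarrow> e \<subseteq> V \<and> 1 \<le> k e \<and> k e \<le> card e"
    using inst by (auto simp: gmssc_instance_def)
  have "sorted_orderings V (\<lambda>_. 0) \<noteq> {}" using V by (rule sorted_orderings_nonempty)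
  then have "orderings V \<noteq> {}" by (auto simp: sorted_orderings_def)
  then have "gmssc_opt V E k \<in> gmssc_cost E k ` orderings V"
    unfolding gmssc_opt_def using finite_orderings[OF V] by (intro Min_in) auto
  then obtain \<sigma> where \<sigma>: "\<sigma> \<in> orderings V" "gmssc_opt V E k = gmssc_cost E k \<sigma>" by blast
  have "lp_value V E u \<le> lp_value V E (\<lambda>e t. of_bool (t \<le> cover_time k \<sigma> e))"
    using opt ordering_lp_feasible[OF inst \<sigma>(1)] unfolding lp_optimal_def by blast
  also have "\<dots> = (\<Sum>e\<in>E. real (cover_time k \<sigma> e))"
    unfolding lp_value_def
  proof (intro sum.cong refl)
    fix e assume "e \<in> E"
    then have "cover_time k \<sigma> e \<le> card V"
      using cover_time_le_card[OF \<sigma>(1)] E by blast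
    then have "{t \<in> {1..card V}. t \<le> cover_time k \<sigma> e} = {1..cover_time k \<sigma> e}" by auto
    then show "(\<Sum>t\<in>{1..card V}. of_bool (t \<le> cover_time k \<sigma> e)) = real (cover_time k \<sigma> e)"
      by (simp only: sum_of_bool_eq_card finite_atLeastAtMost card_atLeastAtMost diff_Suc_1)
  qed
  finally show ?thesis using \<sigma> by (simp add: gmssc_cost_def)
qed

section \<open>Bernoulli tails as probabilities\<close>

lemma bernoulli_tail_empty: "bernoulli_tail p {} k = of_bool (0 < k)"
proof -
  have "(\<Sum>j<k. fps_nth (1 :: real fps) j) = of_bool (0 < k)"
    by (induction k) auto
  then show ?thesis by (simp add: bernoulli_tail_def bernoulli_gf_def)
qed

lemma bernoulli_tail_insert:
  assumes "finite I" "i \<notin> I"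
  shows "bernoulli_tail p (insert i I) k
    = (1 - p i) * bernoulli_tail p I k + p i * bernoulli_tail p I (k - 1)"
proof -
  have tail: "bernoulli_tail p J m = (\<Sum>j<m. mixed_mass 0 p J j)" for J m
    by (simp add: bernoulli_tail_def mixed_mass_def poisson_gf_0)
  show ?thesis
  proof (cases k)
    case 0
    then show ?thesis by (simp add: bernoulli_tail_def)
  next
    case (Suc c)
    then show ?thesis
      using mixed_mass_sum_insert[OF assms, of 0 p c]
      by (simp add: tail lessThan_Suc_atMost[symmetric] algebra_simps)
  qed
qed

lemma bernoulli_tail_bounds:
  assumes "finite I" "\<And>i. i \<in> I \<Longrightarrow> 0 \<le> p i \<and> p i \<le> 1"
  shows "0 \<le> bernoulli_tail p I k" "bernoulli_tail p I k \<le> 1"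
proof -
  have "0 \<le> bernoulli_tail p I k \<and> bernoulli_tail p I k \<le> 1"
    using assms
  proof (induction I arbitrary: k rule: finite_induct)
    case empty
    then show ?case by (simp add: bernoulli_tail_empty)
  next
    case (insert i I)
    have IH: "0 \<le> bernoulli_tail p I m" "bernoulli_tail p I m \<le> 1" for m
      using insert by auto
    have p: "0 \<le> p i" "p i \<le> 1" using insert.prems by auto
    have "(1 - p i) * bernoulli_tail p I k + p i * bernoulli_tail p I (k - 1)
        \<le> (1 - p i) * 1 + p i * 1"
      using IH p by (intro add_mono mult_left_mono) auto
    then show ?case
      using IH p by (simp add: bernoulli_tail_insert[OF insert.hyps])
  qed
  then show "0 \<le> bernoulli_tail p I k" "bernoulli_tail p I k \<le> 1" by auto
qed

lemma bernoulli_tail_reindex: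
  assumes "inj_on h I"
  shows "bernoulli_tail p (h ` I) k = bernoulli_tail (p \<circ> h) I k"
  using assms by (simp add: bernoulli_tail_def bernoulli_gf_def prod.reindex)

text \<open>Serves to remove saturated vertices. Truncated subtraction is right here: with
  \<open>k\<close> or more sure successes the tail is the empty sum.\<close>

lemma bernoulli_tail_Un_sure:
  assumes S: "finite S" and R: "finite R" and "S \<inter> R = {}" and sure: "\<And>i. i \<in> S \<Longrightarrow> p i = 1"
  shows "bernoulli_tail p (S \<union> R) k = bernoulli_tail p R (k - card S)"
  using S assms(3) sure
proof (induction S arbitrary: k rule: finite_induct)
  case empty
  then show ?case by simp
next
  case (insert i S)
  then have "bernoulli_tail p (insert i (S \<union> R)) k = bernoulli_tail p (S \<union> R) (k - 1)"
    using R by (subst bernoulli_tail_insert) auto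
  with insert show ?case by simp
qed

text \<open>Conditioning on one coordinate gives the recursion of
  \<open>bernoulli_tail_insert\<close>.\<close>

lemma emeasure_Pi_pmf_bernoulli:
  assumes "finite I" "\<And>i. i \<in> I \<Longrightarrow> 0 \<le> p i \<and> p i \<le> 1"
  shows "(\<integral>\<^sup>+\<omega>. of_bool (card {i \<in> I. \<omega> i} < k) \<partial>measure_pmf (Pi_pmf I False (\<lambda>i. bernoulli_pmf (p i))))
    = ennreal (bernoulli_tail p I k)"
  using assms
proof (induction I arbitrary: k rule: finite_induct)
  case empty
  then show ?case by (simp add: bernoulli_tail_empty)
next
  case (insert a I)
  let ?M = "measure_pmf (Pi_pmf I False (\<lambda>i. bernoulli_pmf (p i)))"
  have p: "0 \<le> p a" "p a \<le> 1" using insert.prems by auto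
  have IH: "(\<integral>\<^sup>+\<omega>. of_bool (card {i \<in> I. \<omega> i} < m) \<partial>?M) = ennreal (bernoulli_tail p I m)" for m
    using insert by auto
  have step: "(card {i \<in> insert a I. (f(a := y)) i} < k) = (card {i \<in> I. f i} < (if y then k - 1 else k))"
    for f y
  proof -
    have "{i \<in> insert a I. (f(a := y)) i} = (if y then insert a {i \<in> I. f i} else {i \<in> I. f i})"
      using insert.hyps by auto
    then show ?thesis using insert.hyps by auto
  qed
  have "(\<integral>\<^sup>+\<omega>. of_bool (card {i \<in> insert a I. \<omega> i} < k)
           \<partial>measure_pmf (Pi_pmf (insert a I) False (\<lambda>i. bernoulli_pmf (p i))))
      = (\<integral>\<^sup>+y. (\<integral>\<^sup>+\<omega>. of_bool (card {i \<in> I. \<omega> i} < (if y then k - 1 else k)) \<partial>?M)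
           \<partial>measure_pmf (bernoulli_pmf (p a)))"
    by (simp add: Pi_pmf_insert'[OF insert.hyps] step del: fun_upd_apply insert_iff)
  also have "\<dots> = ennreal (bernoulli_tail p I (k - 1)) * ennreal (p a)
       + ennreal (bernoulli_tail p I k) * ennreal (1 - p a)"
    using p by (simp add: IH)
  also have "\<dots> = ennreal (bernoulli_tail p (insert a I) k)"
    using p bernoulli_tail_bounds[of I p] insert.prems insert.hyps
    by (simp add: bernoulli_tail_insert mult.commute add.commute flip: ennreal_mult' ennreal_plus)
  finally show ?case .
qed

text \<open>The predicate speaks of families indexed by \<open>nat\<close> on a sample space in
  \<open>nat \<Rightarrow> bool\<close>; enumerating \<open>I\<close> and taking the product of
  Bernoulli pmfs provides one with the given success probabilities.\<close>

lemma tail_bound_function_bernoulli_tail: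
  fixes p :: "'a \<Rightarrow> real"
  assumes tail: "tail_bound_function P" and I: "finite I"
    and p: "\<And>i. i \<in> I \<Longrightarrow> 0 \<le> p i \<and> p i \<le> 1"
    and k: "1 \<le> k" and \<gamma>: "1 \<le> \<gamma>" and mean: "sum p I = \<gamma> * real k"
  shows "bernoulli_tail p I k \<le> P \<gamma>"
proof -
  obtain h :: "nat \<Rightarrow> 'a" where h: "bij_betw h {0..<card I} I"
    using ex_bij_betw_nat_finite[OF I] by blast
  define J where "J = {0..<card I}"
  define q where "q = p \<circ> h"
  have hJ: "inj_on h J" "h ` J = I" "finite J"
    using h by (auto simp: J_def bij_betw_def)
  have q: "0 \<le> q i \<and> q i \<le> 1" if "i \<in> J" for i
    using that p hJ by (auto simp: q_def)
  define D where "D = Pi_pmf J False (\<lambda>i. bernoulli_pmf (q i))"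
  define Y :: "nat \<Rightarrow> (nat \<Rightarrow> bool) \<Rightarrow> real" where "Y i \<omega> = of_bool (\<omega> i)" for i \<omega>
  have "prob_space.indep_vars (measure_pmf D) (\<lambda>_. borel) (\<lambda>i. (\<lambda>b. of_bool b :: real) \<circ> (\<lambda>\<omega>. \<omega> i)) J"
    unfolding D_def
    by (rule prob_space.indep_vars_compose[OF measure_pmf.prob_space_axioms indep_vars_Pi_pmf[OF hJ(3)]]) auto
  then have indep: "prob_space.indep_vars (measure_pmf D) (\<lambda>_. borel) Y J"
    by (simp add: Y_def[abs_def] o_def)
  have EY: "measure_pmf.expectation D (Y i) = q i" if "i \<in> J" for i
  proof -
    have "measure_pmf.expectation D (Y i)
        = measure_pmf.expectation (map_pmf (\<lambda>\<omega>. \<omega> i) D) of_bool"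
      by (simp add: Y_def[abs_def])
    also have "map_pmf (\<lambda>\<omega>. \<omega> i) D = bernoulli_pmf (q i)"
      using that hJ(3) by (simp add: D_def Pi_pmf_component)
    finally show ?thesis using q[OF that] by simp
  qed
  have "integrable (measure_pmf D) (Y i)" for i
    by (rule measure_pmf.integrable_const_bound[where B = 1]) (auto simp: Y_def)
  then have "measure_pmf.expectation D (\<lambda>\<omega>. \<Sum>i\<in>J. Y i \<omega>) = sum q J"
    using EY by simp
  also have "\<dots> = \<gamma> * real k"
    using mean hJ by (metis q_def sum.reindex)
  finally have E: "measure_pmf.expectation D (\<lambda>\<omega>. \<Sum>i\<in>J. Y i \<omega>) = \<gamma> * real k" .
  have "measure_pmf.prob D {\<omega> \<in> space (measure_pmf D). (\<Sum>i\<in>J. Y i \<omega>) \<le> real k - 1} \<le> P \<gamma>"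
    using tail[unfolded tail_bound_function_def, rule_format, of k \<gamma> "measure_pmf D" J Y]
      k \<gamma> hJ(3) indep E measure_pmf.prob_space_axioms[of D]
    by (simp add: Y_def)
  moreover have "{\<omega> \<in> space (measure_pmf D). (\<Sum>i\<in>J. Y i \<omega>) \<le> real k - 1} = {\<omega>. card {i \<in> J. \<omega> i} < k}"
  proof -
    have "(\<Sum>i\<in>J. Y i \<omega>) = real (card {i \<in> J. \<omega> i})" for \<omega>
      unfolding Y_def by (rule sum_of_bool_eq_card[OF hJ(3)])
    then show ?thesis using k by auto
  qed
  moreover have "ennreal (measure_pmf.prob D {\<omega>. card {i \<in> J. \<omega> i} < k}) = ennreal (bernoulli_tail q J k)"
  proof -
    have "ennreal (measure_pmf.prob D {\<omega>. card {i \<in> J. \<omega> i} < k})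
        = (\<integral>\<^sup>+\<omega>. indicator {\<omega>. card {i \<in> J. \<omega> i} < k} \<omega> \<partial>measure_pmf D)"
      by (simp add: measure_pmf.emeasure_eq_measure)
    also have "\<dots> = (\<integral>\<^sup>+\<omega>. of_bool (card {i \<in> J. \<omega> i} < k) \<partial>measure_pmf D)"
      by (intro nn_integral_cong) (simp add: indicator_def)
    also have "\<dots> = ennreal (bernoulli_tail q J k)"
      unfolding D_def by (rule emeasure_Pi_pmf_bernoulli[OF hJ(3) q])
    finally show ?thesis .
  qed
  moreover have "0 \<le> bernoulli_tail q J k" using bernoulli_tail_bounds[OF hJ(3) q] by simp
  moreover have "bernoulli_tail q J k = bernoulli_tail p I k"
    using bernoulli_tail_reindex[OF hJ(1), of p k] hJ(2) by (simp add: q_def)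
  ultimately show ?thesis by (simp add: measure_nonneg)
qed

section \<open>Independent uniform thresholds\<close>

abbreviation unif :: "real measure" where
  "unif \<equiv> uniform_measure lborel {0..1}"

lemma prob_space_unif: "prob_space unif"
  by (rule prob_space_uniform_measure) auto

lemma emeasure_unif_atMost:
  assumes "0 \<le> z"
  shows "emeasure unif {..z} = ennreal (min 1 z)"
proof -
  have "{0..1} \<inter> {..z} = {0..min 1 z}" by auto
  then show ?thesis using assms by (simp add: divide_ennreal_def)
qed

lemma nn_integral_unif_threshold:
  assumes "0 \<le> z"
  shows "(\<integral>\<^sup>+y. (if y \<le> z then a else b) \<partial>unif) = a * ennreal (min 1 z) + b * ennreal (1 - min 1 z)"
proof -
  interpret prob_space unif by (rule prob_space_unif)
  have gt: "emeasure unif {z<..} = ennreal (1 - min 1 z)"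
  proof -
    have "{0..1} \<inter> {z<..} = {min 1 z<..1}" using assms by auto
    then show ?thesis using assms by (simp add: divide_ennreal_def)
  qed
  have "(\<integral>\<^sup>+y. (if y \<le> z then a else b) \<partial>unif) = (\<integral>\<^sup>+y. a * indicator {..z} y + b * indicator {z<..} y \<partial>unif)"
    by (intro nn_integral_cong) (auto simp: indicator_def)
  also have "\<dots> = a * ennreal (min 1 z) + b * ennreal (1 - min 1 z)"
    by (subst nn_integral_add) (auto simp: nn_integral_cmult emeasure_unif_atMost[OF assms] gt)
  finally show ?thesis .
qed

lemma product_prob_space_unif: "product_prob_space (\<lambda>_. unif)"
  by (intro product_prob_spaceI prob_space_unif)

text \<open>The events \<open>x i \<le> z i\<close> are independent with probabilities
  \<open>min 1 (z i)\<close>; integrating out one coordinate reproduces the recursion of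
  \<open>bernoulli_tail_insert\<close>.\<close>

lemma nn_integral_PiM_unif_tail:
  fixes z :: "'a \<Rightarrow> real"
  assumes "finite I" "\<And>i. i \<in> I \<Longrightarrow> 0 \<le> z i"
  shows "(\<integral>\<^sup>+x. (if (\<Sum>i\<in>I. if x i \<le> z i then 1 else 0 :: real) < real k then 1 else 0) \<partial>PiM I (\<lambda>_. unif))
    = ennreal (bernoulli_tail (\<lambda>i. min 1 (z i)) I k)"
  using assms
proof (induction I arbitrary: k rule: finite_induct)
  case empty
  interpret PE: prob_space "PiM {} (\<lambda>_ :: 'a. unif)" by (rule prob_space_PiM) (rule prob_space_unif)
  show ?case by (simp add: bernoulli_tail_empty PE.emeasure_space_1)
next
  case (insert a I)
  interpret product_prob_space "\<lambda>_ :: 'a. unif" by (rule product_prob_space_unif)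
  let ?p = "\<lambda>i. min 1 (z i)"
  let ?L = "\<lambda>x. \<Sum>i\<in>I. if x i \<le> z i then 1 else 0 :: real"
  define T :: "nat \<Rightarrow> ('a \<Rightarrow> real) \<Rightarrow> ennreal" where "T m x = (if ?L x < real m then 1 else 0)" for m x
  have [measurable]: "T m \<in> borel_measurable (PiM I (\<lambda>_. unif))" for m
    unfolding T_def by measurable
  have z: "0 \<le> z a" using insert.prems by auto
  have IH: "(\<integral>\<^sup>+x. T m x \<partial>PiM I (\<lambda>_. unif)) = ennreal (bernoulli_tail ?p I m)" for m
    using insert.IH[of m] insert.prems by (simp add: T_def)
  have step: "(if (\<Sum>i\<in>insert a I. if (x(a := y)) i \<le> z i then 1 else 0 :: real) < real k then 1 else 0)
      = (if y \<le> z a then T (k - 1) x else T k x)" for x y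
  proof -
    have "(\<Sum>i\<in>I. if (x(a := y)) i \<le> z i then 1 else 0 :: real) = ?L x"
      using insert.hyps by (intro sum.cong) auto
    moreover have "(\<Sum>i\<in>I. if x i \<le> z i then 1 else 0 :: real) \<ge> 0" by (intro sum_nonneg) auto
    ultimately show ?thesis using insert.hyps by (cases k) (auto simp: T_def)
  qed
  have "(\<integral>\<^sup>+x. (if (\<Sum>i\<in>insert a I. if x i \<le> z i then 1 else 0 :: real) < real k then 1 else 0)
          \<partial>PiM (insert a I) (\<lambda>_. unif))
      = (\<integral>\<^sup>+x. (\<integral>\<^sup>+y. (if y \<le> z a then T (k - 1) x else T k x) \<partial>unif) \<partial>PiM I (\<lambda>_. unif))"
    using insert.hyps by (subst product_nn_integral_insert) (simp_all only: step, measurable)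
  also have "\<dots> = (\<integral>\<^sup>+x. ennreal (?p a) * T (k - 1) x + ennreal (1 - ?p a) * T k x \<partial>PiM I (\<lambda>_. unif))"
    by (simp only: nn_integral_unif_threshold[OF z] mult.commute)
  also have "\<dots> = ennreal (?p a) * ennreal (bernoulli_tail ?p I (k - 1))
       + ennreal (1 - ?p a) * ennreal (bernoulli_tail ?p I k)"
    by (subst nn_integral_add) (simp_all add: nn_integral_cmult IH)
  also have "\<dots> = ennreal (bernoulli_tail ?p (insert a I) k)"
    using z bernoulli_tail_bounds[of I ?p] insert.prems insert.hyps
    by (simp add: bernoulli_tail_insert add.commute flip: ennreal_mult' ennreal_plus)
  finally show ?case .
qed

section \<open>Expected cover time of an edge\<close>

text \<open>\<open>T\<close> is the first time in \<open>{t0..<n}\<close> at which \<open>Q\<close>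
  holds, and \<open>n\<close> if there is none. The last property lets a cost at a random time be
  written as a finite sum, which is visibly measurable, and still be evaluated pointwise as
  \<open>c T\<close>.\<close>

lemma first_hit:
  fixes Q :: "nat \<Rightarrow> bool"
  assumes "t0 \<le> n"
  obtains T where "t0 \<le> T" "T \<le> n" "\<And>s. t0 \<le> s \<Longrightarrow> s < T \<Longrightarrow> \<not> Q s" "T < n \<Longrightarrow> Q T"
    "\<And>c :: nat \<Rightarrow> ennreal. (\<Sum>t\<in>{t0..<n}. if Q t \<and> (\<forall>s\<in>{t0..<t}. \<not> Q s) then c t else 0)
        + (if \<forall>s\<in>{t0..<n}. \<not> Q s then c n else 0) = c T"
proof (cases "\<forall>s\<in>{t0..<n}. \<not> Q s")
  case True
  show ?thesis
    by (rule that[of n]) (use True assms in \<open>auto intro!: sum.neutral\<close>)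
next
  case False
  define T where "T = (LEAST s. s \<in> {t0..<n} \<and> Q s)"
  have "\<exists>s. s \<in> {t0..<n} \<and> Q s" using False by blast
  from LeastI_ex[OF this] have T: "T \<in> {t0..<n}" "Q T"
    by (simp_all only: T_def)
  have min: "\<not> Q s" if "t0 \<le> s" "s < T" for s
    using not_less_Least[OF that(2)[unfolded T_def]] that T by auto
  have iff: "Q t \<and> (\<forall>s\<in>{t0..<t}. \<not> Q s) \<longleftrightarrow> t = T" if "t \<in> {t0..<n}" for t
    using T min that by (metis atLeastLessThan_iff linorder_neqE_nat)
  have "(\<Sum>t\<in>{t0..<n}. if Q t \<and> (\<forall>s\<in>{t0..<t}. \<not> Q s) then c t else 0)
      = (\<Sum>t\<in>{t0..<n}. if t = T then c t else 0)" for c :: "nat \<Rightarrow> ennreal"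
    by (intro sum.cong refl) (simp add: iff)
  then have "(\<Sum>t\<in>{t0..<n}. if Q t \<and> (\<forall>s\<in>{t0..<t}. \<not> Q s) then c t else 0) = c T" for c :: "nat \<Rightarrow> ennreal"
    using T by simp
  with T min False show ?thesis by (intro that[of T]) auto
qed

definition hits :: "('v \<Rightarrow> nat \<Rightarrow> real) \<Rightarrow> 'v set \<Rightarrow> ('v \<Rightarrow> real) \<Rightarrow> nat \<Rightarrow> real" where
  "hits Z I \<alpha> t = (\<Sum>v\<in>I. if \<alpha> v \<le> Z v t then 1 else 0)"

lemma hits_eq_card: "finite I \<Longrightarrow> hits Z I \<alpha> t = real (card {v \<in> I. \<alpha> v \<le> Z v t})"
  using sum_of_bool_eq_card[of I "\<lambda>v. \<alpha> v \<le> Z v t"] by (simp add: hits_def of_bool_def)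

lemma hits_measurable [measurable]:
  "I \<subseteq> J \<Longrightarrow> (\<lambda>\<alpha>. hits Z I \<alpha> t) \<in> borel_measurable (PiM J (\<lambda>_. unif))"
  unfolding hits_def by (intro borel_measurable_sum) (measurable, auto)

text \<open>A bound on the cover time of \<open>e\<close> through the first time \<open>t \<ge> t0\<close> at which \<open>K\<close> vertices of \<open>e\<close>
  have been reached; if there is none before \<open>n\<close>, the trivial bound \<open>n\<close> is used.\<close>

definition hit_cost ::
  "('v \<Rightarrow> nat \<Rightarrow> real) \<Rightarrow> 'v set \<Rightarrow> 'v set \<Rightarrow> nat \<Rightarrow> nat \<Rightarrow> nat \<Rightarrow> ('v \<Rightarrow> real) \<Rightarrow> ennreal" where
  "hit_cost Z V e K t0 n \<alpha> =
    (\<Sum>t\<in>{t0..<n}. if real K \<le> hits Z e \<alpha> t \<and> (\<forall>s\<in>{t0..<t}. \<not> real K \<le> hits Z e \<alpha> s)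
        then of_nat K + ennreal (hits Z (V - e) \<alpha> t) else 0)
    + (if \<forall>s\<in>{t0..<n}. \<not> real K \<le> hits Z e \<alpha> s then of_nat n else 0)"

lemma hit_cost_measurable [measurable]:
  "e \<subseteq> V \<Longrightarrow> hit_cost Z V e K t0 n \<in> borel_measurable (PiM V (\<lambda>_. unif))"
  unfolding hit_cost_def by measurable

lemma nn_integral_hits:
  assumes "finite I" "\<And>v. v \<in> I \<Longrightarrow> 0 \<le> Z v t"
  shows "(\<integral>\<^sup>+\<alpha>. ennreal (hits Z I \<alpha> t) \<partial>PiM I (\<lambda>_. unif)) = ennreal (\<Sum>v\<in>I. min 1 (Z v t))"
proof -
  interpret product_prob_space "\<lambda>_ :: 'a. unif" by (rule product_prob_space_unif)
  have one: "(\<integral>\<^sup>+\<alpha>. (if \<alpha> v \<le> Z v t then 1 else 0) \<partial>PiM I (\<lambda>_. unif)) = ennreal (min 1 (Z v t))"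
    if v: "v \<in> I" for v
  proof -
    have "(\<integral>\<^sup>+\<alpha>. (if \<alpha> v \<le> Z v t then 1 else 0) \<partial>PiM I (\<lambda>_. unif))
        = (\<integral>\<^sup>+y. (if y \<le> Z v t then 1 else 0 :: ennreal) \<partial>distr (PiM I (\<lambda>_. unif)) unif (\<lambda>\<alpha>. \<alpha> v))"
      using v by (subst nn_integral_distr) auto
    also have "distr (PiM I (\<lambda>_. unif)) unif (\<lambda>\<alpha>. \<alpha> v) = unif"
      using v by (rule PiM_component)
    finally show ?thesis
      using assms(2)[OF v] by (simp add: nn_integral_unif_threshold)
  qed
  have "ennreal (hits Z I \<alpha> t) = (\<Sum>v\<in>I. if \<alpha> v \<le> Z v t then 1 else 0)" for \<alpha>
  proof -
    have "(\<Sum>v\<in>I. if \<alpha> v \<le> Z v t then 1 else 0 :: ennreal)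
        = (\<Sum>v\<in>I. ennreal (if \<alpha> v \<le> Z v t then 1 else 0))"
      by (intro sum.cong) auto
    then show ?thesis by (simp add: hits_def)
  qed
  then have "(\<integral>\<^sup>+\<alpha>. ennreal (hits Z I \<alpha> t) \<partial>PiM I (\<lambda>_. unif))
     = (\<Sum>v\<in>I. \<integral>\<^sup>+\<alpha>. (if \<alpha> v \<le> Z v t then 1 else 0) \<partial>PiM I (\<lambda>_. unif))"
    by (simp add: nn_integral_sum)
  also have "\<dots> = (\<Sum>v\<in>I. ennreal (min 1 (Z v t)))"
    using one by (rule sum.cong[OF refl])
  also have "\<dots> = ennreal (\<Sum>v\<in>I. min 1 (Z v t))"
    using assms(2) by (intro sum_ennreal) auto
  finally show ?thesis .
qed

text \<open>The vertices outside \<open>e\<close> are independent of the hitting time, so Fubini applies.\<close>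

lemma nn_integral_hit_cost:
  assumes V: "finite V" and e: "e \<subseteq> V" and \<beta>: "1 \<le> \<beta>" and t0: "t0 \<le> n"
    and Z: "\<And>v t. v \<in> V \<Longrightarrow> 0 \<le> Z v t"
    and mass: "\<And>t. t0 \<le> t \<Longrightarrow> t < n \<Longrightarrow> real K + (\<Sum>w\<in>V - e. min 1 (Z w t)) \<le> \<beta> * real t"
  shows "(\<integral>\<^sup>+\<alpha>. hit_cost Z V e K t0 n \<alpha> \<partial>PiM V (\<lambda>_. unif))
    \<le> ennreal \<beta> * (of_nat t0 + (\<Sum>t\<in>{t0..<n}. ennreal (bernoulli_tail (\<lambda>v. min 1 (Z v t)) e K)))"
proof -
  interpret product_prob_space "\<lambda>_ :: 'a. unif" by (rule product_prob_space_unif)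
  interpret PW: prob_space "PiM (V - e) (\<lambda>_. unif)" by (intro prob_space_PiM prob_space_unif)
  interpret PX: prob_space "PiM e (\<lambda>_. unif)" by (intro prob_space_PiM prob_space_unif)
  have fe: "finite e" using e V by (rule finite_subset)
  have Un: "e \<union> (V - e) = V" and Int: "e \<inter> (V - e) = {}" using e by auto
  have hx: "hits Z e (merge e (V - e) (x, y)) t = hits Z e x t" for x y t
    unfolding hits_def by (intro sum.cong refl) simp
  have hy: "hits Z (V - e) (merge e (V - e) (x, y)) t = hits Z (V - e) y t" for x y t
    unfolding hits_def by (intro sum.cong refl) (simp add: Int)
  \<comment> \<open>With the coordinates \<open>x\<close> of \<open>e\<close> fixed, the hitting
    time is a constant \<open>T\<close>; only the hits outside \<open>e\<close> remain
    random.\<close>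
  have inner: "(\<integral>\<^sup>+y. hit_cost Z V e K t0 n (merge e (V - e) (x, y)) \<partial>PiM (V - e) (\<lambda>_. unif))
     \<le> ennreal \<beta> * (of_nat t0 + (\<Sum>t\<in>{t0..<n}. if hits Z e x t < real K then 1 else 0))" for x
  proof -
    define Q where "Q t \<longleftrightarrow> real K \<le> hits Z e x t" for t
    define c where "c y t = (if t < n then of_nat K + ennreal (hits Z (V - e) y t) else of_nat n :: ennreal)" for y t
    obtain T where T: "t0 \<le> T" "T \<le> n" "\<And>s. t0 \<le> s \<Longrightarrow> s < T \<Longrightarrow> \<not> Q s" "T < n \<Longrightarrow> Q T"
      and sum: "\<And>c :: nat \<Rightarrow> ennreal. (\<Sum>t\<in>{t0..<n}. if Q t \<and> (\<forall>s\<in>{t0..<t}. \<not> Q s) then c t else 0)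
        + (if \<forall>s\<in>{t0..<n}. \<not> Q s then c n else 0) = c T"
      by (rule first_hit[OF t0, of Q], rule that)
    have "hit_cost Z V e K t0 n (merge e (V - e) (x, y))
       = (\<Sum>t\<in>{t0..<n}. if Q t \<and> (\<forall>s\<in>{t0..<t}. \<not> Q s) then c y t else 0)
        + (if \<forall>s\<in>{t0..<n}. \<not> Q s then c y n else 0)" for y
      unfolding hit_cost_def hx hy Q_def[symmetric]
      by (intro arg_cong2[where f = plus] sum.cong) (auto simp: c_def)
    then have cost: "hit_cost Z V e K t0 n (merge e (V - e) (x, y)) = c y T" for y
      by (simp only: sum)
    have "(\<integral>\<^sup>+y. c y T \<partial>PiM (V - e) (\<lambda>_. unif)) \<le> ennreal (\<beta> * real T)"
    proof (cases "T < n")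
      case True
      have "(\<integral>\<^sup>+y. c y T \<partial>PiM (V - e) (\<lambda>_. unif))
          = of_nat K + (\<integral>\<^sup>+y. ennreal (hits Z (V - e) y T) \<partial>PiM (V - e) (\<lambda>_. unif))"
        using True by (simp add: c_def nn_integral_add PW.emeasure_space_1)
      also have "\<dots> = ennreal (real K + (\<Sum>w\<in>V - e. min 1 (Z w T)))"
        using V Z by (subst nn_integral_hits)
          (auto simp: ennreal_of_nat_eq_real_of_nat intro!: ennreal_plus[symmetric] sum_nonneg)
      also have "\<dots> \<le> ennreal (\<beta> * real T)"
        using mass[OF T(1) True] by (rule ennreal_leI)
      finally show ?thesis .
    next
      case False
      then have "T = n" using T by simp
      have "real n \<le> \<beta> * real n" using \<beta> mult_right_mono[of 1 \<beta> "real n"] by simp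
      then show ?thesis
        using \<open>T = n\<close> by (simp add: c_def PW.emeasure_space_1 ennreal_of_nat_eq_real_of_nat ennreal_leI)
    qed
    also have "\<dots> = ennreal \<beta> * of_nat T"
      using \<beta> by (simp add: ennreal_mult' ennreal_of_nat_eq_real_of_nat)
    also have "\<dots> \<le> ennreal \<beta> * (of_nat t0 + (\<Sum>t\<in>{t0..<n}. if hits Z e x t < real K then 1 else 0))"
    proof (rule mult_left_mono)
      \<comment> \<open>\<open>T\<close> is \<open>t0\<close> plus the number of times in
        \<open>{t0..<T}\<close>, and \<open>e\<close> is uncovered at each of these.\<close>
      have "of_nat T = of_nat t0 + (\<Sum>t\<in>{t0..<T}. 1 :: ennreal)"
        using T by (simp flip: of_nat_add)
      also have "(\<Sum>t\<in>{t0..<T}. 1 :: ennreal) = (\<Sum>t\<in>{t0..<T}. if hits Z e x t < real K then 1 else 0)"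
        using T(3) by (intro sum.cong refl) (auto simp: Q_def not_le)
      also have "\<dots> \<le> (\<Sum>t\<in>{t0..<n}. if hits Z e x t < real K then 1 else 0)"
        using T by (intro sum_mono2) auto
      finally show "of_nat T \<le> of_nat t0 + (\<Sum>t\<in>{t0..<n}. if hits Z e x t < real K then 1 else 0 :: ennreal)"
        by (simp add: add_left_mono)
    qed simp
    finally show ?thesis by (simp only: cost)
  qed
  have "(\<integral>\<^sup>+\<alpha>. hit_cost Z V e K t0 n \<alpha> \<partial>PiM V (\<lambda>_. unif))
     = (\<integral>\<^sup>+x. (\<integral>\<^sup>+y. hit_cost Z V e K t0 n (merge e (V - e) (x, y)) \<partial>PiM (V - e) (\<lambda>_. unif)) \<partial>PiM e (\<lambda>_. unif))"
    using product_nn_integral_fold[OF Int fe, unfolded Un, OF _ hit_cost_measurable[OF e]] V by simp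
  also have "\<dots> \<le> (\<integral>\<^sup>+x. ennreal \<beta> * (of_nat t0 + (\<Sum>t\<in>{t0..<n}. if hits Z e x t < real K then 1 else 0)) \<partial>PiM e (\<lambda>_. unif))"
    by (intro nn_integral_mono inner)
  also have "\<dots> = ennreal \<beta> * (of_nat t0
      + (\<Sum>t\<in>{t0..<n}. (\<integral>\<^sup>+x. (if hits Z e x t < real K then 1 else 0) \<partial>PiM e (\<lambda>_. unif))))"
    by (simp add: nn_integral_cmult nn_integral_add nn_integral_sum PX.emeasure_space_1)
  also have "\<dots> = ennreal \<beta> * (of_nat t0 + (\<Sum>t\<in>{t0..<n}. ennreal (bernoulli_tail (\<lambda>v. min 1 (Z v t)) e K)))"
    unfolding hits_def using fe e Z by (subst nn_integral_PiM_unif_tail) auto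
  finally show ?thesis .
qed

section \<open>Kernel mass\<close>

text \<open>In the extreme case \<open>u\<close> is 1 on \<open>{1..w}\<close> and 0 afterwards; the
  claim is then that the sum of \<open>1 / s\<close> over \<open>s = w + 1, ..., t\<close> is at
  least \<open>ln ((t + 1) / (w + 1))\<close>.\<close>

lemma ln_le_harmonic_deficit:
  fixes u :: "nat \<Rightarrow> real"
  assumes u: "\<And>s. 0 \<le> u s \<and> u s \<le> 1"
  shows "ln (real (Suc t) / (1 + (\<Sum>s=1..t. u s))) \<le> (\<Sum>s=1..t. (1 - u s) / real s)"
proof (induction t)
  case 0
  then show ?case by simp
next
  case (Suc t)
  define a where "a = real (Suc t)"
  define W where "W = 1 + (\<Sum>s=1..t. u s)"
  define q where "q = u (Suc t)"
  have q: "0 \<le> q" "q \<le> 1" using u by (auto simp: q_def)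
  have a: "0 < a" by (simp add: a_def)
  have "(\<Sum>s=1..t. u s) \<le> (\<Sum>s=1..t. 1)" using u by (intro sum_mono) auto
  then have Wa: "W \<le> a" by (simp add: W_def a_def)
  have W: "1 \<le> W" using u by (auto simp: W_def intro: sum_nonneg)
  \<comment> \<open>The factor by which the argument of \<open>ln\<close> grows from
    \<open>t\<close> to \<open>Suc t\<close>; by \<open>ln y \<le> y - 1\<close> it suffices to
    bound \<open>y - 1\<close> by the new summand.\<close>
  define y where "y = (a + 1) * W / (a * (W + q))"
  have y0: "0 < y" using a W q by (simp add: y_def)
  have den: "0 < a * (W + q)" using a W q by simp
  have "0 \<le> q * (a + 1 - W - q)" using q Wa by simp
  then have "(a + 1) * W - a * (W + q) \<le> (1 - q) * (W + q)" by (simp add: algebra_simps)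
  moreover have "y - 1 = ((a + 1) * W - a * (W + q)) / (a * (W + q))"
    using a W q by (simp add: y_def diff_divide_distrib)
  ultimately have "y - 1 \<le> ((1 - q) * (W + q)) / (a * (W + q))"
    using divide_right_mono[OF _ less_imp_le[OF den]] by metis
  then have y1: "y - 1 \<le> (1 - q) / a" using W q by simp
  have "(a + 1) / (W + q) = a / W * y" using a W q by (simp add: y_def)
  moreover have "0 < a / W" using a W by simp
  ultimately have "ln ((a + 1) / (W + q)) = ln (a / W) + ln y"
    using y0 by (simp only: ln_mult_pos)
  also have "\<dots> \<le> (\<Sum>s=1..t. (1 - u s) / real s) + (1 - q) / a"
    using Suc ln_le_minus_one[OF y0] y1 by (simp add: a_def W_def)
  finally show ?case
    by (simp add: a_def W_def q_def add_ac)
qed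

definition kernel_cum :: "'v set \<Rightarrow> real \<Rightarrow> ('v \<Rightarrow> nat \<Rightarrow> real) \<Rightarrow> 'v \<Rightarrow> nat \<Rightarrow> real" where
  "kernel_cum V \<beta> x v t = (\<Sum>t'\<in>{1..t}. kernel_z V \<beta> x v t')"

lemma kernel_z_nonneg:
  assumes "lp_feasible V E k x u" "1 \<le> \<beta>" "v \<in> V"
  shows "0 \<le> kernel_z V \<beta> x v t"
  using assms unfolding kernel_z_def lp_feasible_def
  by (intro mult_nonneg_nonneg sum_nonneg) auto

lemma kernel_cum_nonneg:
  assumes "lp_feasible V E k x u" "1 \<le> \<beta>" "v \<in> V"
  shows "0 \<le> kernel_cum V \<beta> x v t"
  unfolding kernel_cum_def by (intro sum_nonneg kernel_z_nonneg[OF assms])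

lemma kernel_cum_mono:
  assumes "lp_feasible V E k x u" "1 \<le> \<beta>" "v \<in> V" "s \<le> t"
  shows "kernel_cum V \<beta> x v s \<le> kernel_cum V \<beta> x v t"
  unfolding kernel_cum_def using assms by (intro sum_mono2 kernel_z_nonneg[OF assms(1-3)]) auto

text \<open>At time \<open>s\<close> the kernel spreads \<open>\<beta> / s\<close> times the content
  of the slots \<open>1..s\<close>, each of capacity at most 1, so every time step contributes at
  most \<open>\<beta>\<close>.\<close>

lemma sum_kernel_cum_le:
  assumes lp: "lp_feasible V E k x u" and \<beta>: "1 \<le> \<beta>"
  shows "(\<Sum>v\<in>V. kernel_cum V \<beta> x v t) \<le> \<beta> * real t"
proof -
  have "(\<Sum>v\<in>V. kernel_z V \<beta> x v s) \<le> \<beta>" if s: "1 \<le> s" for s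
  proof -
    have "(\<Sum>v\<in>V. \<Sum>t'\<in>{1..s}. if t' \<le> card V then x v t' else 0)
        = (\<Sum>t'\<in>{1..s}. \<Sum>v\<in>V. if t' \<le> card V then x v t' else 0)"
      by (rule sum.swap)
    also have "\<dots> \<le> (\<Sum>t'\<in>{1..s}. 1)"
    proof (rule sum_mono)
      fix t' assume "t' \<in> {1..s}"
      then show "(\<Sum>v\<in>V. if t' \<le> card V then x v t' else 0) \<le> 1"
        using lp by (cases "t' \<le> card V") (auto simp: lp_feasible_def)
    qed
    finally have "(\<Sum>v\<in>V. \<Sum>t'\<in>{1..s}. if t' \<le> card V then x v t' else 0) \<le> real s" by simp
    then have "\<beta> / real s * (\<Sum>v\<in>V. \<Sum>t'\<in>{1..s}. if t' \<le> card V then x v t' else 0) \<le> \<beta> / real s * real s"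
      using \<beta> by (intro mult_left_mono) auto
    then show ?thesis using s by (simp add: kernel_z_def sum_distrib_left)
  qed
  then have "(\<Sum>s\<in>{1..t}. \<Sum>v\<in>V. kernel_z V \<beta> x v s) \<le> (\<Sum>s\<in>{1..t}. \<beta>)"
    by (intro sum_mono) auto
  then show ?thesis
    unfolding kernel_cum_def by (subst sum.swap) (simp add: mult.commute)
qed

section \<open>Coverage forced by the linear program\<close>

text \<open>At \<open>t = 1\<close> no slot precedes, so the cover inequality with
  \<open>S = {}\<close> reads \<open>k e * u e 1 \<ge> k e\<close>.\<close>

lemma edge_value_ge_1:
  assumes inst: "gmssc_instance V E k" and lp: "lp_feasible V E k x u" and e: "e \<in> E"
  shows "1 \<le> card V" "1 \<le> u e 1" "1 \<le> (\<Sum>t=1..card V. u e t)"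
proof -
  have V: "finite V" and ek: "e \<subseteq> V" "1 \<le> k e" "k e \<le> card e"
    using inst e by (auto simp: gmssc_instance_def)
  have "card e \<le> card V" using V ek(1) by (rule card_mono)
  then show n: "1 \<le> card V" using ek by simp
  then have "real (k e) \<le> real (k e) * u e 1"
    using lp[unfolded lp_feasible_def] e ek by (auto dest!: bspec[of _ _ e] bspec[of _ _ 1] spec[of _ "{}"])
  then show u1: "1 \<le> u e 1" using ek by simp
  have "u e 1 \<le> (\<Sum>t=1..card V. u e t)"
    using lp e n by (intro member_le_sum) (auto simp: lp_feasible_def)
  with u1 show "1 \<le> (\<Sum>t=1..card V. u e t)" by simp
qed

text \<open>Among all \<open>u\<close> with given total, the fractional coverage is smallest when \<open>u\<close> is concentrated
  on the earliest times, where the kernel weights \<open>1 / s\<close> are largest.\<close>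

lemma kernel_cum_coverage:
  assumes inst: "gmssc_instance V E k" and lp: "lp_feasible V E k x u" and e: "e \<in> E"
    and \<beta>: "1 \<le> \<beta>" and t: "t < card V" and S: "S \<subseteq> e" "card S < k e"
  shows "(real (k e) - real (card S)) * (\<beta> * ln (real (Suc t) / (\<Sum>t=1..card V. u e t)))
    \<le> (\<Sum>v\<in>e - S. kernel_cum V \<beta> x v t)"
proof -
  define K where "K = real (k e) - real (card S)"
  define U where "U = (\<Sum>t=1..card V. u e t)"
  \<comment> \<open>The shift is due to the strict inequality \<open>t' < t\<close> in the LP: the
    constraint at \<open>Suc s\<close> controls the slots \<open>1..s\<close>. Capping at 1 meets
    the hypothesis of \<open>ln_le_harmonic_deficit\<close>.\<close>
  define u' where "u' s = (if Suc s \<in> {1..card V} then min 1 (u e (Suc s)) else 0)" for s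
  have K: "0 \<le> K" using S by (simp add: K_def)
  have eV: "e \<subseteq> V" using inst e by (auto simp: gmssc_instance_def)
  have u0: "0 \<le> u e s" if "s \<in> {1..card V}" for s
    using lp e that by (auto simp: lp_feasible_def)
  have u': "0 \<le> u' s \<and> u' s \<le> 1" for s using u0 by (auto simp: u'_def)
  have x0: "0 \<le> x v s" if "v \<in> V" "s \<in> {1..card V}" for v s
    using lp that by (auto simp: lp_feasible_def)
  \<comment> \<open>The leading 1 is accounted for by \<open>u e 1\<close>, which the shift leaves
    out.\<close>
  have "1 + (\<Sum>s=1..t. u' s) \<le> U"
  proof -
    have "(\<Sum>s=1..t. u' s) \<le> (\<Sum>s=1..t. u e (Suc s))"
      using t by (intro sum_mono) (auto simp: u'_def)
    also have "\<dots> = (\<Sum>s=2..Suc t. u e s)"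
      by (simp add: sum.shift_bounds_cl_Suc_ivl[symmetric] numeral_2_eq_2)
    finally have "1 + (\<Sum>s=1..t. u' s) \<le> u e 1 + (\<Sum>s=2..Suc t. u e s)"
      using edge_value_ge_1[OF inst lp e] by simp
    also have "\<dots> = (\<Sum>s=1..Suc t. u e s)"
      by (subst sum.atLeast_Suc_atMost[of 1 "Suc t"]) (auto simp: numeral_2_eq_2)
    also have "\<dots> \<le> U" unfolding U_def using t u0 by (intro sum_mono2) auto
    finally show ?thesis .
  qed
  moreover have "0 < 1 + (\<Sum>s=1..t. u' s)" using u' by (intro add_pos_nonneg sum_nonneg) auto
  ultimately have "ln (real (Suc t) / U) \<le> ln (real (Suc t) / (1 + (\<Sum>s=1..t. u' s)))"
    by (subst ln_le_cancel_iff) (auto intro!: divide_left_mono divide_pos_pos mult_pos_pos)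
  also have "\<dots> \<le> (\<Sum>s=1..t. (1 - u' s) / real s)"
    using u' by (rule ln_le_harmonic_deficit)
  finally have ln_le: "ln (real (Suc t) / U) \<le> (\<Sum>s=1..t. (1 - u' s) / real s)" .
  have cover: "K * (1 - u' s) \<le> (\<Sum>v\<in>e - S. \<Sum>t'\<in>{1..s}. if t' \<le> card V then x v t' else 0)"
    if s: "s \<in> {1..t}" for s
  proof -
    have eq: "(\<Sum>v\<in>e - S. \<Sum>t'\<in>{1..s}. if t' \<le> card V then x v t' else 0)
        = (\<Sum>v\<in>e - S. \<Sum>t'\<in>{1..<Suc s}. x v t')"
      using s t by (intro sum.cong) auto
    have Suc_s: "Suc s \<in> {1..card V}" using s t by auto
    have "K \<le> K * u e (Suc s) + (\<Sum>v\<in>e - S. \<Sum>t'\<in>{1..<Suc s}. x v t')"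
      using lp e Suc_s S unfolding lp_feasible_def K_def by blast
    moreover have "0 \<le> (\<Sum>v\<in>e - S. \<Sum>t'\<in>{1..<Suc s}. x v t')"
      using x0 eV s t by (intro sum_nonneg) auto
    ultimately show ?thesis
      unfolding eq using Suc_s by (auto simp: u'_def min_def algebra_simps)
  qed
  have "K * (\<beta> * ln (real (Suc t) / U)) \<le> K * (\<beta> * (\<Sum>s=1..t. (1 - u' s) / real s))"
    using ln_le K \<beta> by (intro mult_left_mono) auto
  also have "\<dots> = (\<Sum>s=1..t. \<beta> / real s * (K * (1 - u' s)))"
    by (simp add: sum_distrib_left mult_ac)
  also have "\<dots> \<le> (\<Sum>s=1..t. \<beta> / real s * (\<Sum>v\<in>e - S. \<Sum>t'\<in>{1..s}. if t' \<le> card V then x v t' else 0))"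
    using cover \<beta> by (intro sum_mono mult_left_mono) auto
  also have "\<dots> = (\<Sum>s=1..t. \<Sum>v\<in>e - S. kernel_z V \<beta> x v s)"
    by (simp add: kernel_z_def sum_distrib_left)
  also have "\<dots> = (\<Sum>v\<in>e - S. kernel_cum V \<beta> x v t)"
    unfolding kernel_cum_def by (rule sum.swap)
  finally show ?thesis by (simp add: K_def U_def)
qed

text \<open>The accumulated mass is monotone, so a threshold once reached stays reached, and a
  nonempty set of natural numbers attains its infimum. Since \<open>alpha_point\<close> ranges over
  positive times, \<open>t\<close> must be positive.\<close>

lemma alpha_point_le_iff:
  assumes lp: "lp_feasible V E k x u" and "1 \<le> \<beta>" "v \<in> V" "1 \<le> t"
  shows "alpha_point V \<beta> x \<alpha> v \<le> enat t \<longleftrightarrow> \<alpha> v \<le> kernel_cum V \<beta> x v t"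
proof
  assume "\<alpha> v \<le> kernel_cum V \<beta> x v t"
  then show "alpha_point V \<beta> x \<alpha> v \<le> enat t"
    using assms unfolding alpha_point_def kernel_cum_def by (intro Inf_lower) auto
next
  define A where "A = enat ` {t. 1 \<le> t \<and> \<alpha> v \<le> (\<Sum>t'\<in>{1..t}. kernel_z V \<beta> x v t')}"
  assume le: "alpha_point V \<beta> x \<alpha> v \<le> enat t"
  then have "Inf A \<le> enat t" by (simp add: alpha_point_def A_def)
  then have "A \<noteq> {}" by (auto simp: top_enat_def)
  then have "Inf A \<in> A"
    unfolding Inf_enat_def by (auto intro: LeastI)
  then obtain s where s: "1 \<le> s" "\<alpha> v \<le> kernel_cum V \<beta> x v s" "Inf A = enat s"
    unfolding A_def kernel_cum_def by auto
  then have "s \<le> t" using \<open>Inf A \<le> enat t\<close> by simp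
  then show "\<alpha> v \<le> kernel_cum V \<beta> x v t"
    using s kernel_cum_mono[OF lp assms(2,3), of s t] by simp
qed

section \<open>Summing the tail bound\<close>

lemma sum_antimono_le_nn_integral:
  fixes G :: "real \<Rightarrow> ennreal"
  assumes [measurable]: "G \<in> borel_measurable borel"
    and anti: "\<And>x y. 0 < x \<Longrightarrow> x \<le> y \<Longrightarrow> G y \<le> G x"
  shows "(\<Sum>t<n. G (real (Suc t))) \<le> (\<integral>\<^sup>+x\<in>{0<..real n}. G x \<partial>lborel)"
proof (induction n)
  case 0
  then show ?case by simp
next
  case (Suc n)
  have "G (real (Suc n)) = (\<integral>\<^sup>+x. G (real (Suc n)) * indicator {real n<..real (Suc n)} x \<partial>lborel)"
    by (subst nn_integral_cmult_indicator) auto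
  also have "\<dots> \<le> (\<integral>\<^sup>+x\<in>{real n<..real (Suc n)}. G x \<partial>lborel)"
    using anti by (intro nn_integral_mono) (auto simp: indicator_def simp del: of_nat_Suc)
  finally have "(\<Sum>t<Suc n. G (real (Suc t)))
     \<le> (\<integral>\<^sup>+x\<in>{0<..real n}. G x \<partial>lborel) + (\<integral>\<^sup>+x\<in>{real n<..real (Suc n)}. G x \<partial>lborel)"
    using Suc by (simp add: add_mono)
  also have "\<dots> = (\<integral>\<^sup>+x. G x * indicator {0<..real n} x + G x * indicator {real n<..real (Suc n)} x \<partial>lborel)"
    by (rule nn_integral_add[symmetric]) auto
  also have "\<dots> = (\<integral>\<^sup>+x\<in>{0<..real (Suc n)}. G x \<partial>lborel)"
    by (intro nn_integral_cong) (auto simp: indicator_def)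
  finally show ?case .
qed

text \<open>\<open>G\<close> is 1 up to \<open>c\<close> and the tail bound beyond, so the left side
  is a lower Riemann sum of \<open>G\<close> with unit steps. The part up to \<open>c\<close> gives
  the summand 1 in \<open>kernel_r\<close>; the substitution sends \<open>y = 1\<close> to
  \<open>c\<close> and gives the integral.\<close>

lemma sum_tail_le_kernel_r:
  fixes P :: "real \<Rightarrow> real"
  assumes anti: "antimono_on {1..} P" and P1: "P 1 \<le> 1" and \<beta>: "1 \<le> \<beta>" and U: "1 \<le> U"
    and t0: "t0 = min n (nat \<lfloor>U * exp (1 / \<beta>)\<rfloor>)"
  shows "of_nat t0 + (\<Sum>t\<in>{t0..<n}. ennreal (P (\<beta> * ln (real (Suc t) / U)))) \<le> ennreal U * kernel_r P \<beta>"
proof -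
  define c where "c = U * exp (1 / \<beta>)"
  \<comment> \<open>The maximum keeps the interval from \<open>c\<close> to \<open>N\<close>
    nonempty when \<open>n < c\<close>.\<close>
  define N where "N = max c (real n)"
  define Y where "Y = \<beta> * ln (N / U)"
  \<comment> \<open>Extending \<open>P\<close> to the left of 1 by a constant gives an antitone
    function on all reals, which is therefore measurable.\<close>
  define Q where "Q y = P (max 1 y)" for y
  define G where "G x = (if x \<le> c then 1 else ennreal (Q (\<beta> * ln (x / U))))" for x
  have c0: "0 < c" using U by (simp add: c_def)
  have Uc: "\<beta> * ln (c / U) = 1" using U \<beta> by (simp add: c_def)
  have antiQ: "Q y \<le> Q x" if "x \<le> y" for x y
    using that monotone_onD[OF anti, of "max 1 x" "max 1 y"] by (auto simp: Q_def max_def)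
  have Q1: "Q y \<le> 1" for y
    using P1 monotone_onD[OF anti, of 1 "max 1 y"] by (auto simp: Q_def)
  have "(\<lambda>y. - Q y) \<in> borel_measurable borel"
    using antiQ by (intro borel_measurable_mono) (auto simp: mono_def)
  then have "(\<lambda>y. - (- Q y)) \<in> borel_measurable borel" by (rule borel_measurable_uminus)
  then have [measurable]: "Q \<in> borel_measurable borel" by simp
  have [measurable]: "G \<in> borel_measurable borel" unfolding G_def by measurable
  have Gx: "G x = ennreal (P (\<beta> * ln (x / U)))" "1 \<le> \<beta> * ln (x / U)" if "c < x" for x
  proof -
    have "ln (c / U) \<le> ln (x / U)" using that c0 U by (simp add: divide_right_mono)
    then show "1 \<le> \<beta> * ln (x / U)" using mult_left_mono[of "ln (c / U)" "ln (x / U)" \<beta>] \<beta> Uc by simp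
    then show "G x = ennreal (P (\<beta> * ln (x / U)))" using that by (simp add: G_def Q_def max_def)
  qed
  have antiG: "G y \<le> G x" if "0 < x" "x \<le> y" for x y
  proof (cases "x \<le> c")
    case True
    then show ?thesis
      using Q1 ennreal_leI[OF Q1] by (simp add: G_def flip: ennreal_1)
  next
    case False
    then have "ln (x / U) \<le> ln (y / U)" using that U by (simp add: divide_right_mono)
    then have "\<beta> * ln (x / U) \<le> \<beta> * ln (y / U)" using \<beta> by (intro mult_left_mono) auto
    then show ?thesis using False that antiQ by (simp add: G_def ennreal_leI)
  qed
  have "of_nat t0 + (\<Sum>t\<in>{t0..<n}. ennreal (P (\<beta> * ln (real (Suc t) / U)))) = (\<Sum>t<n. G (real (Suc t)))"
  proof -
    have "G (real (Suc t)) = 1" if "t < t0" for t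
    proof -
      have "Suc t \<le> nat \<lfloor>c\<rfloor>" using that t0 by (simp add: c_def)
      then have "real (Suc t) \<le> c" using c0 by (simp add: le_nat_iff le_floor_iff)
      then show ?thesis by (simp add: G_def)
    qed
    then have "of_nat t0 = (\<Sum>t<t0. G (real (Suc t)))" by simp
    moreover have "ennreal (P (\<beta> * ln (real (Suc t) / U))) = G (real (Suc t))" if "t \<in> {t0..<n}" for t
    proof -
      \<comment> \<open>As \<open>t0 \<le> t < n\<close>, the minimum in \<open>t0\<close> is not
        \<open>n\<close>.\<close>
      have "nat \<lfloor>c\<rfloor> \<le> t" using that t0 by (auto simp: c_def)
      then have "c < real (Suc t)" by linarith
      then show ?thesis using Gx(1) by simp
    qed
    ultimately have "of_nat t0 + (\<Sum>t\<in>{t0..<n}. ennreal (P (\<beta> * ln (real (Suc t) / U))))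
       = (\<Sum>t<t0. G (real (Suc t))) + (\<Sum>t\<in>{t0..<n}. G (real (Suc t)))"
      by (intro arg_cong2[where f = plus] sum.cong refl)
    also have "\<dots> = (\<Sum>t<n. G (real (Suc t)))"
      using t0 sum.atLeastLessThan_concat[of 0 t0 n "\<lambda>t. G (real (Suc t))"] by (simp add: lessThan_atLeast0)
    finally show ?thesis .
  qed
  also have "\<dots> \<le> (\<integral>\<^sup>+x\<in>{0<..real n}. G x \<partial>lborel)"
    using antiG by (intro sum_antimono_le_nn_integral) auto
  also have "\<dots> \<le> (\<integral>\<^sup>+x. indicator {0..c} x + ennreal (Q (\<beta> * ln (x / U))) * indicator {c..N} x \<partial>lborel)"
    by (intro nn_integral_mono) (auto simp: indicator_def G_def N_def)
  also have "\<dots> = ennreal c + (\<integral>\<^sup>+x. ennreal (Q (\<beta> * ln (x / U))) * indicator {c..N} x \<partial>lborel)"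
    using c0 by (subst nn_integral_add) auto
  also have "(\<integral>\<^sup>+x. ennreal (Q (\<beta> * ln (x / U))) * indicator {c..N} x \<partial>lborel)
     \<le> ennreal (c / \<beta>) * (\<integral>\<^sup>+x\<in>{1..}. ennreal (P x * exp ((x - 1) / \<beta>)) \<partial>lborel)"
  proof -
    define g where "g y = U * exp (y / \<beta>)" for y
    have N0: "0 < N" using c0 by (simp add: N_def)
    have g1: "g 1 = c" by (simp add: g_def c_def)
    have gY: "g Y = N" using U \<beta> N0 by (simp add: g_def Y_def)
    have "ln (c / U) \<le> ln (N / U)" using c0 U N0 by (simp add: N_def divide_right_mono)
    then have Y1: "1 \<le> Y" using mult_left_mono[of "ln (c / U)" "ln (N / U)" \<beta>] \<beta> Uc by (simp add: Y_def)
    have "(\<integral>\<^sup>+x. ennreal (Q (\<beta> * ln (x / U))) * indicator {c..N} x \<partial>lborel)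
       = (\<integral>\<^sup>+x. ennreal (Q (\<beta> * ln (x / U)) * indicator {g 1..g Y} x) \<partial>lborel)"
      by (intro nn_integral_cong) (auto simp: indicator_def g1 gY)
    also have "\<dots> = (\<integral>\<^sup>+x. ennreal (Q (\<beta> * ln (g x / U)) * (U / \<beta> * exp (x / \<beta>)) * indicator {1..Y} x) \<partial>lborel)"
    proof (rule nn_integral_substitution[OF _ _ _ _ Y1])
      show "set_borel_measurable borel {g 1..g Y} (\<lambda>x. Q (\<beta> * ln (x / U)))"
        unfolding set_borel_measurable_def by measurable
      show "(g has_real_derivative U / \<beta> * exp (x / \<beta>)) (at x)" for x
        unfolding g_def using \<beta> by (auto intro!: derivative_eq_intros)
      show "continuous_on {1..Y} (\<lambda>x. U / \<beta> * exp (x / \<beta>))"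
        using \<beta> by (intro continuous_intros) auto
      show "0 \<le> U / \<beta> * exp (x / \<beta>)" for x using U \<beta> by simp
    qed
    also have "\<dots> \<le> (\<integral>\<^sup>+x. ennreal (c / \<beta>) * (ennreal (P x * exp ((x - 1) / \<beta>)) * indicator {1..} x) \<partial>lborel)"
    proof (rule nn_integral_mono)
      fix x :: real
      have "exp (x / \<beta>) = exp (1 / \<beta>) * exp ((x - 1) / \<beta>)"
        by (simp add: diff_divide_distrib flip: exp_add)
      moreover have "\<beta> * ln (g x / U) = x" using U \<beta> by (simp add: g_def)
      ultimately have "Q (\<beta> * ln (g x / U)) * (U / \<beta> * exp (x / \<beta>)) = c / \<beta> * (P x * exp ((x - 1) / \<beta>))"
        if "1 \<le> x" using that by (simp add: Q_def c_def max_def)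
      then show "ennreal (Q (\<beta> * ln (g x / U)) * (U / \<beta> * exp (x / \<beta>)) * indicator {1..Y} x)
         \<le> ennreal (c / \<beta>) * (ennreal (P x * exp ((x - 1) / \<beta>)) * indicator {1..} x)"
        using c0 \<beta> by (auto simp: indicator_def simp flip: ennreal_mult')
    qed
    also have "\<dots> = (\<integral>\<^sup>+x. ennreal (c / \<beta>) * (ennreal (Q x * exp ((x - 1) / \<beta>)) * indicator {1..} x) \<partial>lborel)"
      by (intro nn_integral_cong) (auto simp: indicator_def Q_def max_def)
    also have "\<dots> = ennreal (c / \<beta>) * (\<integral>\<^sup>+x\<in>{1..}. ennreal (Q x * exp ((x - 1) / \<beta>)) \<partial>lborel)"
      by (rule nn_integral_cmult) measurable
    also have "(\<integral>\<^sup>+x\<in>{1..}. ennreal (Q x * exp ((x - 1) / \<beta>)) \<partial>lborel)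
        = (\<integral>\<^sup>+x\<in>{1..}. ennreal (P x * exp ((x - 1) / \<beta>)) \<partial>lborel)"
      by (intro nn_integral_cong) (auto simp: indicator_def Q_def max_def)
    finally show ?thesis .
  qed
  also have "ennreal c + ennreal (c / \<beta>) * (\<integral>\<^sup>+x\<in>{1..}. ennreal (P x * exp ((x - 1) / \<beta>)) \<partial>lborel)
     = ennreal U * kernel_r P \<beta>"
  proof -
    have "ennreal (c / \<beta>) = ennreal U * ennreal (exp (1 / \<beta>)) * ennreal (1 / \<beta>)"
      using U \<beta> by (simp add: c_def flip: ennreal_mult')
    moreover have "ennreal c = ennreal U * ennreal (exp (1 / \<beta>))"
      using U by (simp add: c_def ennreal_mult')
    ultimately show ?thesis unfolding kernel_r_def by (simp add: distrib_left mult.assoc)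
  qed
  finally show ?thesis by (simp add: add_left_mono)
qed

section \<open>Numerical bounds\<close>

text \<open>Lagrange remainder, whose factor \<open>exp t\<close> is at most 3 on the unit
  interval.\<close>

lemma exp_le_taylor:
  fixes x :: real
  assumes "0 \<le> x" "x \<le> 1"
  shows "exp x \<le> (\<Sum>m<n. x ^ m / fact m) + 3 / fact n * x ^ n"
proof -
  obtain t where t: "\<bar>t\<bar> \<le> \<bar>x\<bar>" "exp x = (\<Sum>m<n. x ^ m / fact m) + exp t / fact n * x ^ n"
    using Maclaurin_exp_le by blast
  have "exp t \<le> exp 1" using t assms by auto
  also have "\<dots> \<le> 3" by (rule exp_le)
  finally have "exp t / fact n * x ^ n \<le> 3 / fact n * x ^ n"
    using assms by (intro mult_right_mono divide_right_mono) auto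
  then show ?thesis using t by simp
qed

lemma taylor_le_exp:
  fixes x :: real
  assumes "0 \<le> x"
  shows "(\<Sum>m<n. x ^ m / fact m) \<le> exp x"
proof -
  obtain t where "exp x = (\<Sum>m<n. x ^ m / fact m) + exp t / fact n * x ^ n"
    using Maclaurin_exp_le by blast
  then show ?thesis using assms by simp
qed

lemma exp_one_ge: "2.718281828 \<le> exp (1 :: real)"
proof -
  have "(2.718281828 :: real) \<le> (\<Sum>m<13. 1 ^ m / fact m)"
    by (simp add: eval_nat_numeral)
  then show ?thesis using taylor_le_exp[of 1 13] by linarith
qed

lemma ln_2_ge: "0.69314718 \<le> ln (2 :: real)"
proof -
  have "exp (0.69314718 :: real) \<le> (\<Sum>m<13. 0.69314718 ^ m / fact m) + 3 / fact 13 * 0.69314718 ^ 13"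
    by (rule exp_le_taylor) auto
  also have "\<dots> \<le> 2"
    by (simp add: eval_nat_numeral)
  finally show ?thesis by (subst ln_ge_iff) simp_all
qed

lemma exp_bound_2191: "exp (1 / 2.191 :: real) \<le> 1.578402"
proof -
  have "exp (1 / 2.191 :: real) \<le> (\<Sum>m<9. (1 / 2.191) ^ m / fact m) + 3 / fact 9 * (1 / 2.191) ^ 9"
    by (rule exp_le_taylor) auto
  also have "\<dots> \<le> 1.578402"
    by (simp add: eval_nat_numeral)
  finally show ?thesis .
qed

lemma exp_bound_20715: "exp (1 / 2.0715 :: real) \<le> 1.6205117177"
proof -
  have "exp (1 / 2.0715 :: real) \<le> (\<Sum>m<13. (1 / 2.0715) ^ m / fact m) + 3 / fact 13 * (1 / 2.0715) ^ 13"
    by (rule exp_le_taylor) auto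
  also have "\<dots> \<le> 1.6205117177"
    by (simp add: eval_nat_numeral)
  finally show ?thesis .
qed

lemma ennreal_kernel_expr:
  assumes "0 \<le> a" "0 \<le> b" "0 \<le> c" "0 \<le> d"
  shows "ennreal a * (ennreal b * (1 + ennreal c * ennreal d)) = ennreal (a * (b * (1 + c * d)))"
  using assms by (simp add: ennreal_mult ennreal_plus)

lemma nn_integral_exp_atLeast_1:
  assumes "0 < (c :: real)"
  shows "(\<integral>\<^sup>+x\<in>{1..}. ennreal (exp (- (c * (x - 1)))) \<partial>lborel) = ennreal (1 / c)"
proof -
  have "(\<integral>\<^sup>+x\<in>{1..}. ennreal (exp (- (c * (x - 1)))) \<partial>lborel)
      = ennreal (0 - (- (exp (- (c * (1 - 1))) / c)))"
  proof (rule nn_integral_FTC_atLeast[where F = "\<lambda>x. - (exp (- (c * (x - 1))) / c)" and T = 0])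
    show "DERIV (\<lambda>x. - (exp (- (c * (x - 1))) / c)) x :> exp (- (c * (x - 1)))" for x
      using assms by (auto intro!: derivative_eq_intros)
    show "((\<lambda>x. - (exp (- (c * (x - 1))) / c)) \<longlongrightarrow> 0) at_top"
      using assms by real_asymp
  qed auto
  then show ?thesis by simp
qed

text \<open>The integrand is half an exponential with decay rate \<open>1 - 1 / \<beta>\<close>,
  positive for \<open>\<beta> > 1\<close>.\<close>

lemma kernel_r_half_exp:
  assumes "1 < \<beta>"
  shows "ennreal \<beta> * kernel_r tail_half_exp \<beta>
    = ennreal (\<beta> * (2 * \<beta> - 1) * exp (1 / \<beta>) / (2 * \<beta> - 2))"
proof -
  have eq: "tail_half_exp x * exp ((x - 1) / \<beta>) = 1 / 2 * exp (- ((1 - 1 / \<beta>) * (x - 1)))" for x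
  proof -
    have "tail_half_exp x * exp ((x - 1) / \<beta>) = 1 / 2 * exp ((1 - x) + (x - 1) / \<beta>)"
      unfolding exp_add by (simp add: tail_half_exp_def)
    also have "(1 - x) + (x - 1) / \<beta> = - ((1 - 1 / \<beta>) * (x - 1))"
      by (simp add: algebra_simps)
    finally show ?thesis .
  qed
  have "(\<integral>\<^sup>+x\<in>{1..}. ennreal (tail_half_exp x * exp ((x - 1) / \<beta>)) \<partial>lborel)
      = (\<integral>\<^sup>+x. ennreal (1 / 2) * (ennreal (exp (- ((1 - 1 / \<beta>) * (x - 1)))) * indicator {1..} x) \<partial>lborel)"
    unfolding eq by (subst ennreal_mult') (simp, simp only: mult.assoc)
  also have "\<dots> = ennreal (1 / 2) * ennreal (1 / (1 - 1 / \<beta>))"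
    using assms by (subst nn_integral_cmult) (auto simp: nn_integral_exp_atLeast_1)
  finally have int: "(\<integral>\<^sup>+x\<in>{1..}. ennreal (tail_half_exp x * exp ((x - 1) / \<beta>)) \<partial>lborel)
    = ennreal (1 / 2 * (1 / (1 - 1 / \<beta>)))"
    by (subst ennreal_mult') simp_all
  have "ennreal \<beta> * kernel_r tail_half_exp \<beta>
     = ennreal (\<beta> * (exp (1 / \<beta>) * (1 + 1 / \<beta> * (1 / 2 * (1 / (1 - 1 / \<beta>))))))"
    unfolding kernel_r_def int using assms by (intro ennreal_kernel_expr) (auto simp: field_simps)
  also have "1 + 1 / \<beta> * (1 / 2 * (1 / (1 - 1 / \<beta>))) = (2 * \<beta> - 1) / (2 * \<beta> - 2)"
    using assms by (simp add: field_simps)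
  finally show ?thesis by (simp add: mult_ac)
qed

lemma half_exp_ratio_2191:
  "(2.191 :: real) * (2 * 2.191 - 1) * exp (1 / 2.191) / (2 * 2.191 - 2) \<le> 4.9102"
  using exp_bound_2191 by simp

text \<open>With \<open>w = exp (1 - x)\<close>, a Taylor polynomial in \<open>w\<close> dominates
  the outer exponential. The integrand is then bounded by a combination of exponentials with rates
  \<open>j + 1 - b\<close>, each of which is integrated exactly.\<close>

lemma kernel_r_double_exp_le:
  "ennreal 2.0715 * kernel_r tail_double_exp 2.0715 \<le> ennreal 4.642"
proof -
  define b :: real where "b = 1 / 2.0715"
  \<comment> \<open>An upper bound for \<open>1 - ln 2\<close>.\<close>
  define c :: real where "c = 0.30685282"
  \<comment> \<open>Taylor coefficients for \<open>j < 7\<close>; the coefficient at 7 carries the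
    factor 3 of the remainder.\<close>
  define d :: "nat \<Rightarrow> real" where "d j = c ^ j / fact j * (if j = 7 then 3 else 1)" for j
  have d0: "0 \<le> d j" for j by (simp add: d_def c_def)
  have b: "0 < b" "b < 1" by (auto simp: b_def)
  have ptw: "tail_double_exp x * exp ((x - 1) / 2.0715)
     \<le> (\<Sum>j<8. exp (- 1) * d j * exp (- ((real j + 1 - b) * (x - 1))))" if x: "1 \<le> x" for x
  proof -
    define w where "w = exp (1 - x)"
    have w: "0 < w" "w \<le> 1" using x by (auto simp: w_def)
    have cw: "0 \<le> c * w" "c * w \<le> 1" using w by (auto simp: c_def intro: mult_le_one)
    have "(1 - ln 2) * w \<le> c * w"
      using ln_2_ge w by (intro mult_right_mono) (auto simp: c_def)
    then have "exp ((1 - ln 2) * w) \<le> exp (c * w)" by simp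
    also have "\<dots> \<le> (\<Sum>m<7. (c * w) ^ m / fact m) + 3 / fact 7 * (c * w) ^ 7"
      using cw by (rule exp_le_taylor)
    also have "\<dots> = (\<Sum>j<8. d j * w ^ j)"
      by (simp add: d_def power_mult_distrib eval_nat_numeral)
    finally have *: "exp ((1 - ln 2) * w) \<le> (\<Sum>j<8. d j * w ^ j)" .
    have bx: "(x - 1) / 2.0715 = b * (x - 1)" by (simp add: b_def)
    have "tail_double_exp x * exp ((x - 1) / 2.0715) = exp ((1 - ln 2) * w) * exp (- x + b * (x - 1))"
      unfolding bx exp_add by (simp add: tail_double_exp_def powr_def ln_div w_def mult_ac)
    also have "\<dots> \<le> (\<Sum>j<8. d j * w ^ j) * exp (- x + b * (x - 1))"
      using * by (intro mult_right_mono) auto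
    also have "\<dots> = (\<Sum>j<8. exp (- 1) * d j * exp (- ((real j + 1 - b) * (x - 1))))"
    proof -
      have "w ^ j * exp (- x + b * (x - 1)) = exp (- 1) * exp (- ((real j + 1 - b) * (x - 1)))" for j
        unfolding w_def exp_of_nat_mult[symmetric] exp_add[symmetric] by (simp add: algebra_simps)
      then show ?thesis
        by (simp add: sum_distrib_right mult.assoc mult.left_commute)
    qed
    finally show ?thesis .
  qed
  have "(\<integral>\<^sup>+x\<in>{1..}. ennreal (tail_double_exp x * exp ((x - 1) / 2.0715)) \<partial>lborel)
     \<le> (\<integral>\<^sup>+x. (\<Sum>j<8. ennreal (exp (- 1) * d j) *
           (ennreal (exp (- ((real j + 1 - b) * (x - 1)))) * indicator {1..} x)) \<partial>lborel)"
  proof (rule nn_integral_mono)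
    fix x :: real
    have "ennreal (tail_double_exp x * exp ((x - 1) / 2.0715))
       \<le> (\<Sum>j<8. ennreal (exp (- 1) * d j) * ennreal (exp (- ((real j + 1 - b) * (x - 1)))))" if "1 \<le> x"
      using ennreal_leI[OF ptw[OF that]] d0
      by (simp add: sum_ennreal[symmetric] ennreal_mult' del: sum_ennreal)
    then show "ennreal (tail_double_exp x * exp ((x - 1) / 2.0715)) * indicator {1..} x
       \<le> (\<Sum>j<8. ennreal (exp (- 1) * d j) *
           (ennreal (exp (- ((real j + 1 - b) * (x - 1)))) * indicator {1..} x))"
      by (auto simp: indicator_def)
  qed
  also have "\<dots> = (\<Sum>j<8. ennreal (exp (- 1) * d j) * ennreal (1 / (real j + 1 - b)))"
    using b by (subst nn_integral_sum)
      (auto simp: nn_integral_cmult nn_integral_exp_atLeast_1 intro!: sum.cong)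
  also have "\<dots> = ennreal (\<Sum>j<8. exp (- 1) * d j * (1 / (real j + 1 - b)))"
    using b d0 by (subst sum_ennreal[symmetric]) (simp_all flip: ennreal_mult')
  also have "\<dots> = ennreal (exp (- 1) * (\<Sum>j<8. d j / (real j + 1 - b)))"
    by (simp add: sum_distrib_left mult.assoc)
  finally have int: "(\<integral>\<^sup>+x\<in>{1..}. ennreal (tail_double_exp x * exp ((x - 1) / 2.0715)) \<partial>lborel)
     \<le> ennreal (exp (- 1) * (\<Sum>j<8. d j / (real j + 1 - b)))" .
  have sum: "(\<Sum>j<8. d j / (real j + 1 - b)) \<le> 2.1556707"
    by (simp add: d_def b_def c_def eval_nat_numeral)
  have sum0: "0 \<le> (\<Sum>j<8. d j / (real j + 1 - b))"
    using d0 b by (intro sum_nonneg) auto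
  have e1: "exp (- 1 :: real) \<le> 1 / 2.718281828"
    using exp_one_ge by (simp add: exp_minus field_simps)
  have "ennreal 2.0715 * kernel_r tail_double_exp 2.0715
     \<le> ennreal 2.0715 * (ennreal (exp b) * (1 + ennreal b * ennreal (exp (- 1) * (\<Sum>j<8. d j / (real j + 1 - b)))))"
    unfolding kernel_r_def b_def[symmetric]
    by (intro mult_left_mono add_left_mono int) auto
  also have "\<dots> = ennreal (2.0715 * (exp b * (1 + b * (exp (- 1) * (\<Sum>j<8. d j / (real j + 1 - b))))))"
    using b sum0 by (intro ennreal_kernel_expr) auto
  also have "\<dots> \<le> ennreal 4.642"
  proof (rule ennreal_leI)
    have "exp (- 1) * (\<Sum>j<8. d j / (real j + 1 - b)) \<le> 1 / 2.718281828 * 2.1556707"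
      using e1 sum sum0 by (intro mult_mono) auto
    then have "1 + b * (exp (- 1) * (\<Sum>j<8. d j / (real j + 1 - b))) \<le> 1 + b * (1 / 2.718281828 * 2.1556707)"
      using b by (intro add_left_mono mult_left_mono) auto
    then have "exp b * (1 + b * (exp (- 1) * (\<Sum>j<8. d j / (real j + 1 - b))))
       \<le> 1.6205117177 * (1 + b * (1 / 2.718281828 * 2.1556707))"
      using exp_bound_20715 b sum0 by (intro mult_mono) (auto simp: b_def)
    also have "\<dots> \<le> 4.642 / 2.0715" by (simp add: b_def)
    finally show "2.0715 * (exp b * (1 + b * (exp (- 1) * (\<Sum>j<8. d j / (real j + 1 - b))))) \<le> 4.642"
      by simp
  qed
  finally show ?thesis .
qed

section \<open>The approximation ratio\<close>

text \<open>From this time on, the expected number of reached vertices of \<open>e\<close> is at least \<open>k e\<close>.\<close>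

definition edge_start :: "'v set \<Rightarrow> real \<Rightarrow> ('v set \<Rightarrow> nat \<Rightarrow> real) \<Rightarrow> 'v set \<Rightarrow> nat" where
  "edge_start V \<beta> u e = min (card V) (nat \<lfloor>(\<Sum>t=1..card V. u e t) * exp (1 / \<beta>)\<rfloor>)"

text \<open>Needed because \<open>alpha_point_le_iff\<close> holds at positive times only.\<close>

lemma edge_start_pos:
  assumes inst: "gmssc_instance V E k" and lp: "lp_feasible V E k x u" and e: "e \<in> E" and \<beta>: "1 \<le> \<beta>"
  shows "1 \<le> edge_start V \<beta> u e"
proof -
  have "1 * 1 \<le> (\<Sum>t=1..card V. u e t) * exp (1 / \<beta>)"
    using edge_value_ge_1(3)[OF inst lp e] \<beta> by (intro mult_mono) auto
  then have "1 \<le> nat \<lfloor>(\<Sum>t=1..card V. u e t) * exp (1 / \<beta>)\<rfloor>" by linarith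
  then show ?thesis
    unfolding edge_start_def using edge_value_ge_1(1)[OF inst lp e] by (rule min.boundedI[rotated])
qed

text \<open>A pathwise bound, valid for all thresholds and every way of breaking ties, so the random
  tie-breaking never has to be analysed.\<close>

lemma cover_time_le_hit_cost:
  assumes inst: "gmssc_instance V E k" and lp: "lp_feasible V E k x u" and e: "e \<in> E" and \<beta>: "1 \<le> \<beta>"
    and \<sigma>: "\<sigma> \<in> sorted_orderings V (alpha_point V \<beta> x \<alpha>)"
  shows "of_nat (cover_time k \<sigma> e)
    \<le> hit_cost (kernel_cum V \<beta> x) V e (k e) (edge_start V \<beta> u e) (card V) \<alpha>"
proof -
  let ?Z = "kernel_cum V \<beta> x"
  let ?n = "card V"
  let ?t0 = "edge_start V \<beta> u e"
  have V: "finite V" and ek: "e \<subseteq> V" "k e \<le> card e"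
    using inst e by (auto simp: gmssc_instance_def)
  have fe: "finite e" using ek(1) V by (rule finite_subset)
  define Q where "Q t \<longleftrightarrow> real (k e) \<le> hits ?Z e \<alpha> t" for t
  define c where "c t = (if t < ?n then of_nat (k e) + ennreal (hits ?Z (V - e) \<alpha> t) else of_nat ?n :: ennreal)" for t
  have le: "?t0 \<le> ?n" by (simp add: edge_start_def)
  obtain T where T: "?t0 \<le> T" "T \<le> ?n" "\<And>s. ?t0 \<le> s \<Longrightarrow> s < T \<Longrightarrow> \<not> Q s" "T < ?n \<Longrightarrow> Q T"
    and sum: "\<And>c :: nat \<Rightarrow> ennreal. (\<Sum>t\<in>{?t0..<?n}. if Q t \<and> (\<forall>s\<in>{?t0..<t}. \<not> Q s) then c t else 0)
        + (if \<forall>s\<in>{?t0..<?n}. \<not> Q s then c ?n else 0) = c T"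
    by (rule first_hit[OF le, of Q], rule that)
  have "hit_cost ?Z V e (k e) ?t0 ?n \<alpha>
     = (\<Sum>t\<in>{?t0..<?n}. if Q t \<and> (\<forall>s\<in>{?t0..<t}. \<not> Q s) then c t else 0)
        + (if \<forall>s\<in>{?t0..<?n}. \<not> Q s then c ?n else 0)"
    unfolding hit_cost_def Q_def[symmetric]
    by (intro arg_cong2[where f = plus] sum.cong) (auto simp: c_def)
  then have cost: "hit_cost ?Z V e (k e) ?t0 ?n \<alpha> = c T" by (simp only: sum)
  have "of_nat (cover_time k \<sigma> e) \<le> c T"
  proof (cases "T < ?n")
    case True
    have T1: "1 \<le> T" using T(1) edge_start_pos[OF inst lp e \<beta>] by simp
    have reached: "{v \<in> I. alpha_point V \<beta> x \<alpha> v \<le> enat T} = {v \<in> I. \<alpha> v \<le> ?Z v T}" if "I \<subseteq> V" for I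
      using alpha_point_le_iff[OF lp \<beta> _ T1] that by blast
    have "k e \<le> card {v \<in> e. \<alpha> v \<le> ?Z v T}"
      using T(4)[OF True] fe by (simp add: Q_def hits_eq_card)
    then have "cover_time k \<sigma> e \<le> k e + card {w \<in> V - e. \<alpha> w \<le> ?Z w T}"
      using cover_time_sorted_le[OF V ek(1) \<sigma>, of k "enat T"] reached[OF ek(1)] reached[of "V - e"] by simp
    then have "(of_nat (cover_time k \<sigma> e) :: ennreal) \<le> of_nat (k e + card {w \<in> V - e. \<alpha> w \<le> ?Z w T})"
      by (rule of_nat_mono)
    then show ?thesis
      using True V by (simp add: c_def hits_eq_card ennreal_of_nat_eq_real_of_nat)
  next
    case False
    have "\<sigma> \<in> orderings V" using \<sigma> by (simp add: sorted_orderings_def)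
    then have "cover_time k \<sigma> e \<le> ?n" using ek by (rule cover_time_le_card)
    then have "(of_nat (cover_time k \<sigma> e) :: ennreal) \<le> of_nat ?n" by (rule of_nat_mono)
    then show ?thesis using False by (simp add: c_def)
  qed
  then show ?thesis by (simp only: cost)
qed

text \<open>At each time the vertices of mass at least 1 form a set \<open>S\<close> of sure hits.
  The others are an instance with requirement \<open>k e - card S\<close>, for which the cover
  inequality of this very \<open>S\<close> provides the expected coverage.\<close>

lemma nn_integral_edge_hit_cost:
  fixes P :: "real \<Rightarrow> real" and V :: "'v set"
  assumes tail: "\<And>(I :: 'v set) p K \<gamma>. finite I \<Longrightarrow> (\<And>i. i \<in> I \<Longrightarrow> 0 \<le> p i \<and> p i \<le> 1) \<Longrightarrow> 1 \<le> K \<Longrightarrow>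
      1 \<le> \<gamma> \<Longrightarrow> sum p I = \<gamma> * real K \<Longrightarrow> bernoulli_tail p I K \<le> P \<gamma>"
    and anti: "antimono_on {1..} P" and P1: "P 1 \<le> 1" and \<beta>: "1 \<le> \<beta>"
    and inst: "gmssc_instance V E k" and lp: "lp_feasible V E k x u" and e: "e \<in> E"
  shows "(\<integral>\<^sup>+\<alpha>. hit_cost (kernel_cum V \<beta> x) V e (k e) (edge_start V \<beta> u e) (card V) \<alpha> \<partial>PiM V (\<lambda>_. unif))
    \<le> ennreal \<beta> * kernel_r P \<beta> * ennreal (\<Sum>t=1..card V. u e t)"
proof -
  let ?Z = "kernel_cum V \<beta> x"
  let ?n = "card V"
  let ?t0 = "edge_start V \<beta> u e"
  define U where "U = (\<Sum>t=1..card V. u e t)"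
  have V: "finite V" and ek: "e \<subseteq> V" "1 \<le> k e" "k e \<le> card e"
    using inst e by (auto simp: gmssc_instance_def)
  have fe: "finite e" using ek(1) V by (rule finite_subset)
  have U: "1 \<le> U" using edge_value_ge_1[OF inst lp e] by (simp add: U_def)
  have Z: "0 \<le> ?Z v t" if "v \<in> V" for v t using kernel_cum_nonneg[OF lp \<beta> that] .
  \<comment> \<open>The choice of the start time keeps the argument of \<open>P\<close> in
    \<open>{1..}\<close>.\<close>
  have rate: "1 \<le> \<beta> * ln (real (Suc t) / U)" if t: "?t0 \<le> t" "t < ?n" for t
  proof -
    have "nat \<lfloor>U * exp (1 / \<beta>)\<rfloor> \<le> t" using t by (auto simp: edge_start_def U_def)
    then have "U * exp (1 / \<beta>) < real (Suc t)" by linarith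
    then have "exp (1 / \<beta>) \<le> real (Suc t) / U" using U by (simp add: field_simps)
    then have "1 / \<beta> \<le> ln (real (Suc t) / U)" using U by (subst ln_ge_iff) auto
    then show ?thesis using \<beta> by (simp add: field_simps)
  qed
  have cover: "real (k e - card S) * (\<beta> * ln (real (Suc t) / U)) \<le> (\<Sum>v\<in>e - S. ?Z v t)"
    if "S \<subseteq> e" "card S < k e" "t < ?n" for S t
    using kernel_cum_coverage[OF inst lp e \<beta> that(3,1,2)] that(2) by (simp add: U_def of_nat_diff)
  have split: "(\<Sum>v\<in>e. f v) = (\<Sum>v\<in>{v \<in> e. 1 \<le> ?Z v t}. f v) + (\<Sum>v\<in>e - {v \<in> e. 1 \<le> ?Z v t}. f v)"
    for f :: "'v \<Rightarrow> real" and t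
    using fe by (subst add.commute) (rule sum.subset_diff, auto)
  have "(\<integral>\<^sup>+\<alpha>. hit_cost ?Z V e (k e) ?t0 ?n \<alpha> \<partial>PiM V (\<lambda>_. unif))
    \<le> ennreal \<beta> * (of_nat ?t0 + (\<Sum>t\<in>{?t0..<?n}. ennreal (bernoulli_tail (\<lambda>v. min 1 (?Z v t)) e (k e))))"
  proof (rule nn_integral_hit_cost[OF V ek(1) \<beta> _ Z])
    show "?t0 \<le> ?n" by (simp add: edge_start_def)
  next
    fix t assume t: "?t0 \<le> t" "t < ?n"
    define S where "S = {v \<in> e. 1 \<le> ?Z v t}"
    \<comment> \<open>This lets the summand \<open>k e\<close> of the position be absorbed by the
      truncated mass of \<open>e\<close>, so that the total mass bounds the whole position.\<close>
    have "real (k e) \<le> (\<Sum>v\<in>e. min 1 (?Z v t))"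
    proof (cases "card S < k e")
      case True
      have "real (k e - card S) * 1 \<le> real (k e - card S) * (\<beta> * ln (real (Suc t) / U))"
        using rate[OF t] by (intro mult_left_mono) auto
      also have "\<dots> \<le> (\<Sum>v\<in>e - S. ?Z v t)" using True t by (intro cover) (auto simp: S_def)
      also have "\<dots> = (\<Sum>v\<in>e - S. min 1 (?Z v t))" by (intro sum.cong) (auto simp: S_def)
      finally have "real (k e) \<le> real (card S) + (\<Sum>v\<in>e - S. min 1 (?Z v t))"
        using True by (simp add: of_nat_diff)
      also have "real (card S) = (\<Sum>v\<in>S. min 1 (?Z v t))"
        by (simp add: S_def)
      finally show ?thesis using split[of "\<lambda>v. min 1 (?Z v t)" t] by (simp add: S_def)
    next
      case False
      have "real (k e) \<le> (\<Sum>v\<in>S. min 1 (?Z v t))" using False by (simp add: S_def)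
      also have "\<dots> \<le> (\<Sum>v\<in>e. min 1 (?Z v t))"
        using fe Z ek(1) by (intro sum_mono2) (auto simp: S_def)
      finally show ?thesis .
    qed
    then have "real (k e) + (\<Sum>w\<in>V - e. min 1 (?Z w t)) \<le> (\<Sum>v\<in>V. min 1 (?Z v t))"
      using sum.subset_diff[OF ek(1) V, of "\<lambda>v. min 1 (?Z v t)"] by simp
    also have "\<dots> \<le> (\<Sum>v\<in>V. ?Z v t)" by (intro sum_mono) simp
    also have "\<dots> \<le> \<beta> * real t" by (rule sum_kernel_cum_le[OF lp \<beta>])
    finally show "real (k e) + (\<Sum>w\<in>V - e. min 1 (?Z w t)) \<le> \<beta> * real t" .
  qed
  also have "\<dots> \<le> ennreal \<beta> * (of_nat ?t0 + (\<Sum>t\<in>{?t0..<?n}. ennreal (P (\<beta> * ln (real (Suc t) / U)))))"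
  proof (intro mult_left_mono add_left_mono sum_mono)
    fix t assume "t \<in> {?t0..<?n}"
    then have t: "?t0 \<le> t" "t < ?n" by auto
    define S where "S = {v \<in> e. 1 \<le> ?Z v t}"
    let ?p = "\<lambda>v. min 1 (?Z v t)"
    have fS: "finite S" "finite (e - S)" using fe by (auto simp: S_def)
    have "bernoulli_tail ?p (S \<union> (e - S)) (k e) = bernoulli_tail ?p (e - S) (k e - card S)"
      using fS by (rule bernoulli_tail_Un_sure) (auto simp: S_def)
    moreover have "S \<union> (e - S) = e" by (auto simp: S_def)
    ultimately have eq: "bernoulli_tail ?p e (k e) = bernoulli_tail ?p (e - S) (k e - card S)" by simp
    show "ennreal (bernoulli_tail ?p e (k e)) \<le> ennreal (P (\<beta> * ln (real (Suc t) / U)))"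
    proof (cases "card S < k e")
      case True
      \<comment> \<open>The exact ratio of mean to requirement in the residual instance, at which
        the tail bound applies; monotonicity of \<open>P\<close> then passes to the smaller
        logarithmic argument.\<close>
      define \<gamma> where "\<gamma> = (\<Sum>v\<in>e - S. ?p v) / real (k e - card S)"
      have pos: "0 < real (k e - card S)" using True by simp
      have "(\<Sum>v\<in>e - S. ?p v) = (\<Sum>v\<in>e - S. ?Z v t)" by (intro sum.cong) (auto simp: S_def)
      then have "real (k e - card S) * (\<beta> * ln (real (Suc t) / U)) \<le> (\<Sum>v\<in>e - S. ?p v)"
        using cover[of S t] True t by (simp add: S_def)
      then have \<gamma>: "\<beta> * ln (real (Suc t) / U) \<le> \<gamma>"
        using pos by (simp add: \<gamma>_def field_simps)
      have \<gamma>1: "1 \<le> \<gamma>" using \<gamma> rate[OF t] by linarith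
      have mean: "sum ?p (e - S) = \<gamma> * real (k e - card S)" using pos by (simp add: \<gamma>_def)
      have "bernoulli_tail ?p (e - S) (k e - card S) \<le> P \<gamma>"
        using True Z ek(1) by (intro tail[OF fS(2) _ _ \<gamma>1 mean]) auto
      also have "\<dots> \<le> P (\<beta> * ln (real (Suc t) / U))"
        using \<gamma> rate[OF t] by (intro monotone_onD[OF anti]) auto
      finally show ?thesis unfolding eq by (rule ennreal_leI)
    next
      case False
      then show ?thesis unfolding eq by (simp add: bernoulli_tail_def)
    qed
  qed auto
  also have "\<dots> \<le> ennreal \<beta> * (ennreal U * kernel_r P \<beta>)"
    using anti P1 \<beta> U by (intro mult_left_mono sum_tail_le_kernel_r) (auto simp: edge_start_def U_def)
  finally show ?thesis by (simp add: U_def mult_ac)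
qed

text \<open>The tail hypothesis is phrased through \<open>bernoulli_tail\<close>, so that it can be
  supplied both by an abstract tail bound function and by the explicit estimates.\<close>

lemma approx_ratio_le_kernel_r:
  fixes P :: "real \<Rightarrow> real"
  assumes tail: "\<And>(I :: 'v set) p K \<gamma>. finite I \<Longrightarrow> (\<And>i. i \<in> I \<Longrightarrow> 0 \<le> p i \<and> p i \<le> 1) \<Longrightarrow> 1 \<le> K \<Longrightarrow>
      1 \<le> \<gamma> \<Longrightarrow> sum p I = \<gamma> * real K \<Longrightarrow> bernoulli_tail p I K \<le> P \<gamma>"
    and anti: "antimono_on {1..} P" and P1: "P 1 \<le> 1" and \<beta>: "1 \<le> \<beta>"
  shows "approx_ratio TYPE('v) \<beta> \<le> ennreal \<beta> * kernel_r P \<beta>"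
  unfolding approx_ratio_def
proof (rule Sup_least, clarify)
  fix V :: "'v set" and E k x u
  assume inst: "gmssc_instance V E k" and opt: "lp_optimal V E k x u"
  have lp: "lp_feasible V E k x u" using opt by (simp add: lp_optimal_def)
  have V: "finite V" and E: "\<And>e. e \<in> E \<Longrightarrow> e \<subseteq> V"
    using inst by (auto simp: gmssc_instance_def)
  let ?H = "\<lambda>e. hit_cost (kernel_cum V \<beta> x) V e (k e) (edge_start V \<beta> u e) (card V)"
  have "expected_cost V E k \<beta> x \<le> (\<integral>\<^sup>+\<alpha>. (\<Sum>e\<in>E. ?H e \<alpha>) \<partial>PiM V (\<lambda>_. unif))"
    unfolding expected_cost_def
  proof (rule nn_integral_mono)
    fix \<alpha> :: "'v \<Rightarrow> real"
    let ?S = "sorted_orderings V (alpha_point V \<beta> x \<alpha>)"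
    have "(\<integral>\<^sup>+\<sigma>. of_nat (gmssc_cost E k \<sigma>) \<partial>measure_pmf (pmf_of_set ?S))
        \<le> (\<integral>\<^sup>+\<sigma>. (\<Sum>e\<in>E. ?H e \<alpha>) \<partial>measure_pmf (pmf_of_set ?S))"
    proof (rule nn_integral_mono_AE)
      have "of_nat (gmssc_cost E k \<sigma>) \<le> (\<Sum>e\<in>E. ?H e \<alpha>)" if "\<sigma> \<in> ?S" for \<sigma>
        unfolding gmssc_cost_def of_nat_sum
        by (intro sum_mono cover_time_le_hit_cost[OF inst lp _ \<beta> that])
      then show "AE \<sigma> in measure_pmf (pmf_of_set ?S). of_nat (gmssc_cost E k \<sigma>) \<le> (\<Sum>e\<in>E. ?H e \<alpha>)"
        using sorted_orderings_nonempty[OF V] finite_sorted_orderings[OF V]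
        by (auto simp: AE_measure_pmf_iff)
    qed
    then show "(\<integral>\<^sup>+\<sigma>. of_nat (gmssc_cost E k \<sigma>) \<partial>measure_pmf (pmf_of_set ?S)) \<le> (\<Sum>e\<in>E. ?H e \<alpha>)"
      by (simp add: measure_pmf.emeasure_space_1)
  qed
  also have "\<dots> = (\<Sum>e\<in>E. \<integral>\<^sup>+\<alpha>. ?H e \<alpha> \<partial>PiM V (\<lambda>_. unif))"
    using E by (intro nn_integral_sum hit_cost_measurable)
  also have "\<dots> \<le> (\<Sum>e\<in>E. ennreal \<beta> * kernel_r P \<beta> * ennreal (\<Sum>t=1..card V. u e t))"
    by (intro sum_mono nn_integral_edge_hit_cost[OF tail anti P1 \<beta> inst lp])
  also have "\<dots> = ennreal \<beta> * kernel_r P \<beta> * (\<Sum>e\<in>E. ennreal (\<Sum>t=1..card V. u e t))"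
    by (simp only: sum_distrib_left)
  also have "(\<Sum>e\<in>E. ennreal (\<Sum>t=1..card V. u e t)) = ennreal (lp_value V E u)"
    unfolding lp_value_def using lp by (intro sum_ennreal sum_nonneg) (auto simp: lp_feasible_def)
  also have "ennreal \<beta> * kernel_r P \<beta> * ennreal (lp_value V E u)
      \<le> ennreal \<beta> * kernel_r P \<beta> * of_nat (gmssc_opt V E k)"
    using lp_optimal_le_opt[OF inst opt]
    by (intro mult_left_mono) (auto simp: ennreal_of_nat_eq_real_of_nat intro: ennreal_leI)
  finally have bound: "expected_cost V E k \<beta> x \<le> ennreal \<beta> * kernel_r P \<beta> * of_nat (gmssc_opt V E k)" .
  show "expected_cost V E k \<beta> x / of_nat (gmssc_opt V E k) \<le> ennreal \<beta> * kernel_r P \<beta>"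
  \<comment> \<open>\<open>kernel_r\<close> may be infinite, but in \<open>ennreal\<close> its
    product with 0 is 0; the expected cost then vanishes and the quotient is 0.\<close>
  proof (cases "gmssc_opt V E k = 0")
    case True
    then have "expected_cost V E k \<beta> x = 0" using bound by simp
    then show ?thesis by simp
  next
    case False
    have "expected_cost V E k \<beta> x / of_nat (gmssc_opt V E k)
        \<le> ennreal \<beta> * kernel_r P \<beta> * of_nat (gmssc_opt V E k) / of_nat (gmssc_opt V E k)"
      using bound by (rule divide_right_mono_ennreal)
    also have "\<dots> = ennreal \<beta> * kernel_r P \<beta>"
      using False by (simp add: ennreal_mult_divide_eq)
    finally show ?thesis .
  qed
qed

section \<open>The two explicit tail bounds\<close>

lemma tail_double_exp_antimono: "antimono_on {1..} tail_double_exp"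
proof (rule monotone_onI)
  fix x y :: real assume "x \<in> {1..}" "y \<in> {1..}" "x \<le> y"
  then have "exp (- y) * exp ((1 - ln 2) * exp (1 - y)) \<le> exp (- x) * exp ((1 - ln 2) * exp (1 - x))"
    using ln_2_less_1 by (intro mult_mono) (auto intro: mult_left_mono)
  then show "tail_double_exp y \<le> tail_double_exp x" by (simp add: tail_double_exp_eq)
qed

lemma tail_half_exp_antimono: "antimono_on {1..} tail_half_exp"
  by (auto simp: tail_half_exp_def intro!: monotone_onI)

text \<open>Bounding the inner \<open>exp (1 - \<gamma>)\<close> by 1 turns one bound into the
  other, so the simpler bound inherits its validity as a tail estimate.\<close>

lemma tail_double_exp_le_half_exp:
  assumes "1 \<le> \<gamma>"
  shows "tail_double_exp \<gamma> \<le> tail_half_exp \<gamma>"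
proof -
  have "(1 - ln 2) * exp (1 - \<gamma>) \<le> (1 - ln 2) * 1"
    using assms ln_2_less_1 by (intro mult_left_mono) auto
  then have "- \<gamma> + (1 - ln 2) * exp (1 - \<gamma>) \<le> (1 - \<gamma>) - ln 2" by simp
  then have "exp (- \<gamma> + (1 - ln 2) * exp (1 - \<gamma>)) \<le> exp ((1 - \<gamma>) - ln 2)" by simp
  moreover have "exp ((1 - \<gamma>) - ln 2) = exp (1 - \<gamma>) / 2" by (subst exp_diff) simp
  ultimately show ?thesis by (simp only: tail_double_exp_eq tail_half_exp_def exp_add)
qed

lemma approx_ratio_le_double_exp:
  assumes "1 \<le> \<beta>"
  shows "approx_ratio TYPE('v) \<beta> \<le> ennreal \<beta> * kernel_r tail_double_exp \<beta>"
proof (rule approx_ratio_le_kernel_r[OF bernoulli_tail_le_double_exp tail_double_exp_antimono _ assms])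
  show "tail_double_exp 1 \<le> 1" by (simp add: tail_double_exp_def exp_minus)
qed

lemma approx_ratio_le_half_exp:
  assumes "1 \<le> \<beta>"
  shows "approx_ratio TYPE('v) \<beta> \<le> ennreal \<beta> * kernel_r tail_half_exp \<beta>"
proof (rule approx_ratio_le_kernel_r[OF _ tail_half_exp_antimono _ assms])
  show "tail_half_exp 1 \<le> 1" by (simp add: tail_half_exp_def)
next
  fix I :: "'v set" and p K \<gamma>
  assume "finite I" "\<And>i. i \<in> I \<Longrightarrow> 0 \<le> p i \<and> p i \<le> 1" "1 \<le> K" "1 \<le> \<gamma>" "sum p I = \<gamma> * real K"
  then show "bernoulli_tail p I K \<le> tail_half_exp \<gamma>"
    by (intro order_trans[OF bernoulli_tail_le_double_exp tail_double_exp_le_half_exp])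
qed

theorem theorem8:
  shows "(\<forall>(P :: real \<Rightarrow> real) (\<beta> :: real).
            tail_bound_function P \<and> convex_on {1..} P \<and> antimono_on {1..} P \<and> P 1 \<le> 1 \<and> 1 \<le> \<beta>
            \<longrightarrow> approx_ratio TYPE('v) \<beta> \<le> ennreal \<beta> * kernel_r P \<beta>)
       \<and> (\<forall>\<beta> > (1 :: real).
            ennreal \<beta> * kernel_r tail_half_exp \<beta>
              = ennreal (\<beta> * (2 * \<beta> - 1) * exp (1 / \<beta>) / (2 * \<beta> - 2))
            \<and> approx_ratio TYPE('v) \<beta>
                \<le> ennreal (\<beta> * (2 * \<beta> - 1) * exp (1 / \<beta>) / (2 * \<beta> - 2)))
       \<and> (2.191 :: real) * (2 * 2.191 - 1) * exp (1 / 2.191) / (2 * 2.191 - 2) \<le> 4.9102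
       \<and> approx_ratio TYPE('v) 2.191 \<le> ennreal 4.9102
       \<and> ennreal 2.0715 * kernel_r tail_double_exp 2.0715 \<le> ennreal 4.642
       \<and> approx_ratio TYPE('v) 2.0715 \<le> ennreal 4.642"
proof (intro conjI allI impI)
  fix P :: "real \<Rightarrow> real" and \<beta> :: real
  assume "tail_bound_function P \<and> convex_on {1..} P \<and> antimono_on {1..} P \<and> P 1 \<le> 1 \<and> 1 \<le> \<beta>"
  then show "approx_ratio TYPE('v) \<beta> \<le> ennreal \<beta> * kernel_r P \<beta>"
    by (intro approx_ratio_le_kernel_r tail_bound_function_bernoulli_tail) auto
next
  fix \<beta> :: real assume \<beta>: "1 < \<beta>"
  then show "ennreal \<beta> * kernel_r tail_half_exp \<beta>
      = ennreal (\<beta> * (2 * \<beta> - 1) * exp (1 / \<beta>) / (2 * \<beta> - 2))"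
    by (rule kernel_r_half_exp)
  with \<beta> show "approx_ratio TYPE('v) \<beta> \<le> ennreal (\<beta> * (2 * \<beta> - 1) * exp (1 / \<beta>) / (2 * \<beta> - 2))"
    using approx_ratio_le_half_exp[of \<beta>, where 'v = 'v] by simp
next
  show half: "(2.191 :: real) * (2 * 2.191 - 1) * exp (1 / 2.191) / (2 * 2.191 - 2) \<le> 4.9102"
    by (rule half_exp_ratio_2191)
  have "approx_ratio TYPE('v) 2.191 \<le> ennreal 2.191 * kernel_r tail_half_exp 2.191"
    by (rule approx_ratio_le_half_exp) simp
  also have "\<dots> = ennreal (2.191 * (2 * 2.191 - 1) * exp (1 / 2.191) / (2 * 2.191 - 2))"
    by (rule kernel_r_half_exp) simp
  also have "\<dots> \<le> ennreal 4.9102" using half by (rule ennreal_leI)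
  finally show "approx_ratio TYPE('v) 2.191 \<le> ennreal 4.9102" .
next
  show double: "ennreal 2.0715 * kernel_r tail_double_exp 2.0715 \<le> ennreal 4.642"
    by (rule kernel_r_double_exp_le)
  have "approx_ratio TYPE('v) 2.0715 \<le> ennreal 2.0715 * kernel_r tail_double_exp 2.0715"
    by (rule approx_ratio_le_double_exp) simp
  also note double
  finally show "approx_ratio TYPE('v) 2.0715 \<le> ennreal 4.642" .
qed

end
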